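(* We have $$ N(V;B)=\frac{\pi B^2}{2\zeta(2)} \sum_{\substack{(\lambda,\mu)\in \mathbb{Z}_{\mathrm{prim}}^2\\ \mu\neq 0}} \frac{1}{\sqrt{f(\lambda,\mu)}}+O(B^{3/2}\log B), $$ where $f(\lambda,\mu)=\lambda^6+2\lambda^4\mu^2+\lambda^2\mu^4+\mu^6$.
   Context: Let $W\subset\mathbb{P}^3$ be the Cayley ruled cubic surface over $\mathbb{Q}$ defined by $t_0t_1t_2-t_0^2t_3-t_1^3=0$, and let $V=W\setminus\{t_0=t_1=0\}$ be the complement of the double line in $W$. For $n\geq 1$, $\mathbb{Z}^n_{\mathrm{prim}}$ denotes the set of primitive vectors in $\mathbb{Z}^n$, i.e. those whose coordinates have greatest common divisor $1$. The height $H:V(\mathbb{Q})\to\mathbb{R}_{>0}$ is metrized by the Euclidean norm: $H(t)=\|\mathbf{t}\|:=\sqrt{t_0^2+t_1^2+t_2^2+t_3^2}$ if $t$ is represented by a primitive vector $\mathbf{t}=(t_0,t_1,t_2,t_3)\in\mathbb{Z}^4_{\mathrm{prim}}$. The counting function is $N(V;B)=\#\{t\in V(\mathbb{Q}): H(t)\leq B\}$, studied as $B\to\infty$, and $\zeta$ is the Riemann zeta function.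
   Formalization: The sum is taken over primitive (λ,μ) with μ>0, i.e. each pair ±(λ,μ) once; the printed sum over all primitive (λ,μ) with μ≠0 counts every line of the ruling twice, so the printed main term is too large by a factor 2. *)

theory Defs
  imports "HOL-Analysis.Analysis" "HOL-Library.Landau_Symbols"
begin

text \<open>
  Coordinates are numbered from 0 as in $(t_0 : t_1 : t_2 : t_3)$. The index types \<open>2\<close> and \<open>4\<close>
  are the residue types of \<open>Numeral_Type\<close>, so \<open>0, 1\<close> and \<open>0, 1, 2, 3\<close> are all their elements.
\<close>

definition primitive_vectors :: "(int ^ 'n) set" where
  "primitive_vectors = {v. Gcd (range (\<lambda>i. v $ i)) = 1}"

text \<open>Projective space over \<open>\<rat>\<close>: nonzero vectors up to a nonzero scalar.\<close>

definition proportional :: "((rat ^ 'n) \<times> (rat ^ 'n)) set" where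
  "proportional = {(x, y). x \<noteq> 0 \<and> y \<noteq> 0 \<and> (\<exists>c. c \<noteq> 0 \<and> y = c *s x)}"

definition projective_points :: "(rat ^ 'n) set set" where
  "projective_points = (UNIV - {0}) // proportional"

definition cayley_cubic :: "(rat ^ 4) set set" where
  "cayley_cubic =
     {P \<in> projective_points. \<forall>t\<in>P. t $ 0 * t $ 1 * t $ 2 - (t $ 0)^2 * t $ 3 - (t $ 1)^3 = 0}"

definition double_line :: "(rat ^ 4) set set" where
  "double_line = {P \<in> projective_points. \<forall>t\<in>P. t $ 0 = 0 \<and> t $ 1 = 0}"

definition V_points :: "(rat ^ 4) set set" where
  "V_points = cayley_cubic - double_line"

text \<open>
  The primitive representative of a point is unique up to sign, so its Euclidean norm is unique.
\<close>

definition height :: "(rat ^ 'n) set \<Rightarrow> real" where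
  "height P = (THE h. \<exists>t\<in>primitive_vectors.
     (\<chi> i. of_int (t $ i)) \<in> P \<and> h = norm (\<chi> i. real_of_int (t $ i)))"

definition counting_function :: "real \<Rightarrow> nat" where
  "counting_function B = card {P \<in> V_points. height P \<le> B}"

definition f_form :: "int \<Rightarrow> int \<Rightarrow> int" where
  "f_form l m = l^6 + 2 * l^4 * m^2 + l^2 * m^4 + m^6"

text \<open>
  One vector out of each pair \<open>(l, m)\<close>, \<open>(- l, - m)\<close> of primitive vectors with \<open>m \<noteq> 0\<close>, namely the
  one with \<open>m > 0\<close>. The two vectors of a pair are the same point \<open>(l : m)\<close> and belong to the same
  line of the ruling, so summing over all primitive vectors with \<open>m \<noteq> 0\<close> would count every line twice.
\<close>

definition ruling_parameters :: "(int ^ 2) set" where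
  "ruling_parameters = {v \<in> primitive_vectors. v $ 1 > 0}"

text \<open>The Dirichlet series of the Riemann zeta function; meaningful for \<open>s > 1\<close> only.\<close>

definition zeta :: "real \<Rightarrow> real" where
  "zeta s = (\<Sum>n. 1 / real (Suc n) powr s)"

end

theory Submission
  imports Defs "HOL-Computational_Algebra.Squarefree"
begin

text \<open>
The surface is ruled: the points with \<open>t\<^sub>1 / t\<^sub>0 = l / m\<close>, for coprime \<open>l\<close> and \<open>m > 0\<close>, form a
line minus its point on the double line. The integer vectors on the plane above this line are
\<open>(m\<^sup>2 w, l m w, l\<^sup>2 w + m z, l z)\<close> with integers \<open>w\<close>, \<open>z\<close>, and such a vector is primitive exactly when
\<open>(w, z)\<close> is. One vector of each pair \<open>\<plusminus>t\<close> is selected by \<open>w > 0\<close>; the condition \<open>w \<noteq> 0\<close> is what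
keeps the point off the double line. So counting points of height at most \<open>B\<close> means counting,
line by line, the coprime pairs \<open>(w, z)\<close> with \<open>w > 0\<close> in an ellipse \<open>a w\<^sup>2 + 2 b w z + d z\<^sup>2 \<le> B\<^sup>2\<close>, where
\<open>d = l\<^sup>2 + m\<^sup>2\<close> (\<open>bij_betw_cayley_point\<close>, \<open>height_cayley_point\<close>).

The discriminant \<open>D = a d - b\<^sup>2\<close> is \<open>f(m, l)\<close>, with the arguments of \<open>f\<close> in the opposite order to that
of the theorem. Exchanging \<open>l\<close> and \<open>m\<close> (up to sign) permutes the lines with \<open>l \<noteq> 0\<close>, and the one
remaining line \<open>(0, 1)\<close> satisfies \<open>f(1, 0) = f(0, 1)\<close>, so the two sums agree
(\<open>line_weight_reindex\<close>).

For one line, half the ellipse has area \<open>\<pi> B\<^sup>2 / (2 \<surd>D)\<close>. Its lattice points are counted row by row,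
each row with error at most 1, and the row lengths add up to the area because they are the
heights of a quarter disc (\<open>sum_quarter_circle\<close>); the total error is \<open>O(B / \<surd>d)\<close>
(\<open>card_half_ellipse\<close>). Moebius inversion over the common divisor of \<open>w\<close> and \<open>z\<close> divides the
main term by \<open>\<zeta>(2)\<close> and costs a factor \<open>log B\<close> in the error (\<open>card_coprime_half_ellipse\<close>).

Let \<open>k = max |l| m\<close>, so that \<open>\<surd>d \<ge> k\<close> and \<open>\<surd>D \<ge> k\<^sup>3 / 2\<close>. A line with \<open>k > \<surd>(2 B)\<close> has no point of height
at most \<open>B\<close> (\<open>line_points_nonempty_imp\<close>), and at most \<open>4 k\<close> lines share a given \<open>k\<close>. Hence the errors
of the lines with \<open>k \<le> \<surd>(2 B)\<close> add up to \<open>O(B log B \<Sum> k / k) = O(B\<^bsup>3/2\<^esup> log B)\<close>, and the main terms of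
the other lines to \<open>O(B\<^sup>2 \<Sum> k / k\<^sup>3) = O(B\<^bsup>3/2\<^esup>)\<close> (\<open>counting_function_estimate\<close>).
\<close>

section \<open>Moebius inversion\<close>

definition moebius :: "nat \<Rightarrow> real" where
  "moebius n = (if squarefree n then (- 1) ^ card (prime_factors n) else 0)"

lemma abs_moebius_le_1: "\<bar>moebius n\<bar> \<le> 1"
  by (simp add: moebius_def power_abs)

lemma moebius_prime_mult:
  assumes "prime p" "\<not> p dvd e"
  shows "moebius (p * e) = - moebius e"
proof -
  have cop: "coprime p e"
    using assms by (rule prime_imp_coprime)
  have e0: "e \<noteq> 0" and p0: "p \<noteq> 0"
    using assms by (auto intro: ccontr)
  have "prime_factors (p * e) = insert p (prime_factors e)"
    using e0 p0 assms(1) by (simp add: prime_factors_product prime_prime_factors)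
  moreover have "p \<notin> prime_factors e"
    using assms by (auto dest: in_prime_factors_imp_dvd)
  ultimately have "card (prime_factors (p * e)) = Suc (card (prime_factors e))"
    by simp
  moreover have "squarefree (p * e) \<longleftrightarrow> squarefree e"
    using cop assms(1) by (metis squarefree_mult_coprime squarefree_multD(2) squarefree_prime)
  ultimately show ?thesis
    by (simp add: moebius_def)
qed

text \<open>
Fix a prime \<open>p\<close> dividing \<open>n\<close>. The divisors \<open>e\<close> prime to \<open>p\<close> pair off with the divisors \<open>p e\<close>, the two terms of
a pair cancel, and the divisors left over are divisible by \<open>p\<^sup>2\<close> and contribute nothing.
\<close>
lemma sum_moebius_divisors:
  assumes "n > 0"
  shows "(\<Sum>d | d dvd n. moebius d) = (if n = 1 then 1 else 0)"
proof (cases "n = 1")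
  case True
  then show ?thesis
    by (simp add: moebius_def)
next
  case False
  then obtain p where p: "prime p" "p dvd n"
    by (meson prime_factor_nat)
  define A where "A = {d. d dvd n \<and> \<not> p dvd d}"
  have fin: "finite {d. d dvd n}"
    using assms by simp
  have inj: "inj_on ((*) p) A"
    using p by (auto simp: inj_on_def)
  have "(\<Sum>d | d dvd n \<and> p dvd d. moebius d) = (\<Sum>d\<in>(*) p ` A. moebius d)"
  proof (rule sum.mono_neutral_right)
    show "finite {d. d dvd n \<and> p dvd d}"
      using fin by simp
    show "(*) p ` A \<subseteq> {d. d dvd n \<and> p dvd d}"
      using p by (auto simp: A_def intro!: divides_mult prime_imp_coprime)
    show "\<forall>d\<in>{d. d dvd n \<and> p dvd d} - (*) p ` A. moebius d = 0"
    proof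
      fix d assume d: "d \<in> {d. d dvd n \<and> p dvd d} - (*) p ` A"
      then obtain e where e: "d = p * e"
        by auto
      with d have "e dvd n"
        by (auto dest: dvd_mult_right)
      with d e have "p dvd e"
        by (auto simp: A_def)
      then have "p ^ 2 dvd d"
        using e by (auto simp: power2_eq_square)
      then have "\<not> squarefree d"
        using p by (intro not_squarefreeI[of p]) auto
      then show "moebius d = 0"
        by (simp add: moebius_def)
    qed
  qed
  also have "\<dots> = (\<Sum>e\<in>A. moebius (p * e))"
    using inj by (simp add: sum.reindex)
  also have "\<dots> = (\<Sum>e\<in>A. - moebius e)"
    using p by (intro sum.cong) (auto simp: A_def moebius_prime_mult)
  finally have "(\<Sum>d | d dvd n \<and> p dvd d. moebius d) = - (\<Sum>e\<in>A. moebius e)"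
    by (simp add: sum_negf)
  moreover have "(\<Sum>d | d dvd n. moebius d) = (\<Sum>d\<in>A. moebius d) + (\<Sum>d | d dvd n \<and> p dvd d. moebius d)"
    unfolding A_def
    by (subst sum.union_disjoint[symmetric]) (use fin in \<open>auto intro!: sum.cong\<close>)
  ultimately show ?thesis
    using False by simp
qed

lemma sum_moebius_common_divisors:
  assumes "n > 0" "n \<le> N"
  shows "(\<Sum>d = 1..N. if d dvd n then moebius d else 0) = (if n = 1 then 1 else 0)"
proof -
  have "(\<Sum>d = 1..N. if d dvd n then moebius d else 0) = (\<Sum>d | d dvd n. moebius d)"
  proof (rule sum.mono_neutral_cong_right)
    show "{d. d dvd n} \<subseteq> {1..N}"
      using assms by (auto intro: dvd_imp_le[THEN le_trans] simp: Suc_le_eq dvd_pos_nat)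
  qed auto
  then show ?thesis
    using sum_moebius_divisors[OF assms(1)] by simp
qed

text \<open>
Summing the Moebius function over the common divisors of \<open>w\<close> and \<open>z\<close> detects coprimality; exchanging
the two sums leaves a count of pairs divisible by \<open>d\<close>. The bound on \<open>w\<close> makes the sum over \<open>d\<close> finite.
\<close>
lemma card_coprime_pairs:
  fixes S :: "(int \<times> int) set"
  assumes fin: "finite S" and S: "\<And>w z. (w, z) \<in> S \<Longrightarrow> 0 < w \<and> w \<le> int N"
  shows "real (card {(w, z) \<in> S. coprime w z}) =
    (\<Sum>d = 1..N. moebius d * real (card {(w, z) \<in> S. int d dvd w \<and> int d dvd z}))"
proof -
  have "real (card {(w, z) \<in> S. coprime w z}) = (\<Sum>v\<in>S. if coprime (fst v) (snd v) then 1 else 0)"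
  proof -
    have "{(w, z) \<in> S. coprime w z} = {v \<in> S. coprime (fst v) (snd v)}"
      by auto
    then show ?thesis
      using fin by (simp add: sum.If_cases Int_def)
  qed
  also have "\<dots> = (\<Sum>v\<in>S. \<Sum>d = 1..N. if d dvd nat (gcd (fst v) (snd v)) then moebius d else 0)"
  proof (rule sum.cong[OF refl])
    fix v assume "v \<in> S"
    then have w: "0 < fst v" "fst v \<le> int N"
      using S[of "fst v" "snd v"] by auto
    have le: "gcd (fst v) (snd v) \<le> int N"
      using gcd_le1_int[OF w(1), of "snd v"] w(2) by linarith
    have pos: "gcd (fst v) (snd v) > 0"
      using w by auto
    show "(if coprime (fst v) (snd v) then 1 else 0) =
      (\<Sum>d = 1..N. if d dvd nat (gcd (fst v) (snd v)) then moebius d else 0)"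
      using le pos by (subst sum_moebius_common_divisors) (auto simp: coprime_iff_gcd_eq_1)
  qed
  also have "\<dots> = (\<Sum>d = 1..N. \<Sum>v\<in>S. if d dvd nat (gcd (fst v) (snd v)) then moebius d else 0)"
    by (rule sum.swap)
  also have "\<dots> = (\<Sum>d = 1..N. moebius d * real (card {(w, z) \<in> S. int d dvd w \<and> int d dvd z}))"
  proof (rule sum.cong[OF refl])
    fix d
    have "d dvd nat (gcd (fst v) (snd v)) \<longleftrightarrow> int d dvd fst v \<and> int d dvd snd v" for v :: "int \<times> int"
      by (metis dvd_gcdD1 dvd_gcdD2 gcd_ge_0_int gcd_greatest int_dvd_int_iff int_nat_eq)
    then show "(\<Sum>v\<in>S. if d dvd nat (gcd (fst v) (snd v)) then moebius d else 0) =
      moebius d * real (card {(w, z) \<in> S. int d dvd w \<and> int d dvd z})"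
      using fin by (simp add: sum.If_cases Int_def case_prod_unfold)
  qed
  finally show ?thesis .
qed

section \<open>The value of the zeta function at 2\<close>

text \<open>
Telescoping \<open>1 / n\<^sup>2 \<le> 1 / (n - 1) - 1 / n\<close>, with the first term estimated on its own so that \<open>K = 0\<close> is
covered.
\<close>
lemma sum_inverse_squares_tail:
  assumes "K < N"
  shows "(\<Sum>d = Suc K..N. 1 / real d ^ 2) \<le> 2 / real (Suc K) - 1 / real N"
  using Suc_leI[OF assms]
proof (induction N rule: dec_induct)
  case base
  have "1 / real (Suc K) ^ 2 \<le> 1 / real (Suc K)"
    by (intro divide_left_mono) (auto simp: power2_eq_square)
  then show ?case
    by (simp add: divide_simps)
next
  case (step n)
  have "1 / real (Suc n) ^ 2 \<le> 1 / real n - 1 / real (Suc n)"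
    using step by (simp add: divide_simps power2_eq_square)
  then show ?case
    using step by simp
qed

lemma zeta_2_sums: "(\<lambda>n. 1 / real (Suc n) ^ 2) sums zeta 2"
proof -
  have "summable (\<lambda>n. 1 / real (Suc n) ^ 2)"
    using inverse_power_summable[of 2, where ?'a = real]
    by (subst summable_Suc_iff) (simp add: inverse_eq_divide)
  then have "(\<lambda>n. 1 / real (Suc n) ^ 2) sums (\<Sum>n. 1 / real (Suc n) ^ 2)"
    by (rule summable_sums)
  moreover have "zeta 2 = (\<Sum>n. 1 / real (Suc n) ^ 2)"
    unfolding zeta_def by (intro arg_cong[where f = suminf] ext) (simp add: powr_numeral)
  ultimately show ?thesis
    by simp
qed

lemma zeta_2_partial_sums:
  shows "(\<Sum>j = 1..n. 1 / real j ^ 2) \<le> zeta 2"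
    and "zeta 2 \<le> (\<Sum>j = 1..n. 1 / real j ^ 2) + 2 / real (Suc n)"
proof -
  have eq: "(\<Sum>j<m. 1 / real (Suc j) ^ 2) = (\<Sum>j = 1..m. 1 / real j ^ 2)" for m
    by (rule sum.reindex_bij_witness[of _ "\<lambda>j. j - 1" Suc]) auto
  show "(\<Sum>j = 1..n. 1 / real j ^ 2) \<le> zeta 2"
    unfolding eq[symmetric] sums_unique[OF zeta_2_sums]
    by (rule sum_le_suminf) (use zeta_2_sums in \<open>auto simp: sums_iff\<close>)
  show "zeta 2 \<le> (\<Sum>j = 1..n. 1 / real j ^ 2) + 2 / real (Suc n)"
    unfolding sums_unique[OF zeta_2_sums]
  proof (rule suminf_le_const)
    show "summable (\<lambda>n. 1 / real (Suc n) ^ 2)"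
      using zeta_2_sums by (auto simp: sums_iff)
    fix m
    show "(\<Sum>j<m. 1 / real (Suc j) ^ 2) \<le> (\<Sum>j = 1..n. 1 / real j ^ 2) + 2 / real (Suc n)"
    proof (cases "n < m")
      case True
      have "(\<Sum>j = 1..m. 1 / real j ^ 2) = (\<Sum>j = 1..n. 1 / real j ^ 2) + (\<Sum>j = Suc n..m. 1 / real j ^ 2)"
        using True by (subst sum.union_disjoint[symmetric]) (auto intro!: sum.cong)
      moreover have "0 \<le> 1 / real m"
        by simp
      ultimately show ?thesis
        using sum_inverse_squares_tail[OF True] unfolding eq by linarith
    next
      case False
      then have "(\<Sum>j = 1..m. 1 / real j ^ 2) \<le> (\<Sum>j = 1..n. 1 / real j ^ 2)"
        by (intro sum_mono2) auto
      moreover have "0 \<le> 2 / real (Suc n)"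
        by simp
      ultimately show ?thesis
        unfolding eq by linarith
    qed
  qed
qed

lemma zeta_2_ge_1: "1 \<le> zeta 2"
  using zeta_2_partial_sums(1)[of 1] by simp

lemma sum_inverse_le_ln:
  assumes "K \<ge> 1"
  shows "(\<Sum>d = 1..K. 1 / real d) \<le> 1 + ln (real K)"
  using assms
proof (induction K rule: dec_induct)
  case (step n)
  have "ln (real n / real (Suc n)) \<le> real n / real (Suc n) - 1"
    using step by (intro ln_le_minus_one) auto
  also have "\<dots> = - (1 / real (Suc n))"
    by (simp add: divide_simps)
  finally have "1 / real (Suc n) \<le> ln (real (Suc n)) - ln (real n)"
    using step by (simp add: ln_div)
  then show ?case
    using step by simp
qed simp

text \<open>
The finite form of \<open>\<Sum> \<mu>(d) / d\<^sup>2 \<cdot> \<zeta>(2) = 1\<close>: grouping the terms with \<open>d j = k \<le> K\<close> gives \<open>1 / k\<^sup>2\<close> times the sum of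
the Moebius function over the divisors of \<open>k\<close>. Working with partial sums avoids rearranging an infinite
double series and yields a rate of convergence at once.
\<close>
lemma sum_moebius_over_squares_times_partial_zeta:
  assumes "K \<ge> 1"
  shows "(\<Sum>d = 1..K. moebius d / real d ^ 2 * (\<Sum>j = 1..K div d. 1 / real j ^ 2)) = 1"
proof -
  have "(\<Sum>d = 1..K. moebius d / real d ^ 2 * (\<Sum>j = 1..K div d. 1 / real j ^ 2)) =
    (\<Sum>d = 1..K. \<Sum>k = 1..K. (if d dvd k then moebius d else 0) / real k ^ 2)"
  proof (rule sum.cong[OF refl])
    fix d assume d: "d \<in> {1..K}"
    have "(\<Sum>k = 1..K. (if d dvd k then moebius d else 0) / real k ^ 2) =
      (\<Sum>k\<in>(*) d ` {1..K div d}. moebius d / real k ^ 2)"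
    proof (rule sum.mono_neutral_cong_right)
      show "(*) d ` {1..K div d} \<subseteq> {1..K}"
        using d by (auto simp: Suc_le_eq less_eq_div_iff_mult_less_eq mult.commute)
      show "\<forall>i\<in>{1..K} - (*) d ` {1..K div d}. (if d dvd i then moebius d else 0) / real i ^ 2 = 0"
      proof (intro ballI)
        fix i assume i: "i \<in> {1..K} - (*) d ` {1..K div d}"
        have "\<not> d dvd i"
        proof
          assume "d dvd i"
          then obtain j where j: "i = d * j" ..
          then have "j \<in> {1..K div d}"
            using i d by (auto simp: less_eq_div_iff_mult_less_eq mult.commute Suc_le_eq)
          with i j show False
            by auto
        qed
        then show "(if d dvd i then moebius d else 0) / real i ^ 2 = 0"
          by simp
      qed
    qed auto
    also have "\<dots> = (\<Sum>j = 1..K div d. moebius d / real (d * j) ^ 2)"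
      using d by (subst sum.reindex) (auto simp: inj_on_def)
    also have "\<dots> = moebius d / real d ^ 2 * (\<Sum>j = 1..K div d. 1 / real j ^ 2)"
      by (simp add: sum_distrib_left power_mult_distrib)
    finally show "moebius d / real d ^ 2 * (\<Sum>j = 1..K div d. 1 / real j ^ 2) =
      (\<Sum>k = 1..K. (if d dvd k then moebius d else 0) / real k ^ 2)" ..
  qed
  also have "\<dots> = (\<Sum>k = 1..K. (\<Sum>d = 1..K. if d dvd k then moebius d else 0) / real k ^ 2)"
    by (subst sum.swap) (simp add: sum_divide_distrib)
  also have "\<dots> = (\<Sum>k = 1..K. (if k = 1 then 1 else 0) / real k ^ 2)"
    by (intro sum.cong refl) (subst sum_moebius_common_divisors, auto)
  also have "\<dots> = (\<Sum>k = 1..K. if k = 1 then 1 else 0)"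
    by (intro sum.cong) auto
  also have "\<dots> = 1"
    using assms by simp
  finally show ?thesis .
qed

text \<open>
Replacing \<open>\<zeta>(2)\<close> by its partial sum up to \<open>K div d\<close> costs at most \<open>2 d / K\<close>, so the total error is
\<open>(2 / K) \<Sum> 1 / d\<close>. The logarithm is harmless here, since the error terms of the lattice point counts
contain one anyway.
\<close>
lemma sum_moebius_over_squares:
  assumes "K \<ge> 1"
  shows "\<bar>(\<Sum>d = 1..K. moebius d / real d ^ 2) - 1 / zeta 2\<bar> \<le> 2 * (1 + ln (real K)) / real K"
proof -
  let ?T = "\<Sum>d = 1..K. moebius d / real d ^ 2"
  have "\<bar>zeta 2 * ?T - 1\<bar> =
    \<bar>\<Sum>d = 1..K. moebius d / real d ^ 2 * (zeta 2 - (\<Sum>j = 1..K div d. 1 / real j ^ 2))\<bar>"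
    by (subst sum_moebius_over_squares_times_partial_zeta[OF assms, symmetric])
       (simp add: sum_distrib_left sum_subtractf algebra_simps)
  also have "\<dots> \<le> (\<Sum>d = 1..K. \<bar>moebius d / real d ^ 2 * (zeta 2 - (\<Sum>j = 1..K div d. 1 / real j ^ 2))\<bar>)"
    by (rule sum_abs)
  also have "\<dots> \<le> (\<Sum>d = 1..K. 2 / real K * (1 / real d))"
  proof (rule sum_mono)
    fix d assume d: "d \<in> {1..K}"
    have "K < d * Suc (K div d)"
      using d by (metis atLeastAtMost_iff dividend_less_times_div mult_Suc_right less_eq_Suc_le One_nat_def)
    then have "real K \<le> real d * real (Suc (K div d))"
      by (metis of_nat_le_iff of_nat_mult less_imp_le)
    then have "2 / real (Suc (K div d)) \<le> 2 * real d / real K"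
      using d by (simp add: divide_simps mult.commute)
    then have "\<bar>zeta 2 - (\<Sum>j = 1..K div d. 1 / real j ^ 2)\<bar> \<le> 2 * real d / real K"
      using zeta_2_partial_sums[of "K div d"] by linarith
    moreover have "\<bar>moebius d / real d ^ 2\<bar> \<le> 1 / real d ^ 2"
      using abs_moebius_le_1[of d] by (simp add: abs_divide divide_right_mono)
    ultimately have "\<bar>moebius d / real d ^ 2 * (zeta 2 - (\<Sum>j = 1..K div d. 1 / real j ^ 2))\<bar>
      \<le> 1 / real d ^ 2 * (2 * real d / real K)"
      unfolding abs_mult by (intro mult_mono) auto
    also have "\<dots> = 2 / real K * (1 / real d)"
      using d by (simp add: power2_eq_square)
    finally show "\<bar>moebius d / real d ^ 2 * (zeta 2 - (\<Sum>j = 1..K div d. 1 / real j ^ 2))\<bar>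
      \<le> 2 / real K * (1 / real d)" .
  qed
  also have "\<dots> = 2 / real K * (\<Sum>d = 1..K. 1 / real d)"
    by (simp add: sum_distrib_left)
  also have "\<dots> \<le> 2 / real K * (1 + ln (real K))"
    using sum_inverse_le_ln[OF assms] by (intro mult_left_mono) auto
  finally have *: "\<bar>zeta 2 * ?T - 1\<bar> \<le> 2 * (1 + ln (real K)) / real K"
    by simp
  have "\<bar>?T - 1 / zeta 2\<bar> \<le> zeta 2 * \<bar>?T - 1 / zeta 2\<bar>"
    using mult_right_mono[OF zeta_2_ge_1, of "\<bar>?T - 1 / zeta 2\<bar>"] by simp
  also have "\<dots> = \<bar>zeta 2 * (?T - 1 / zeta 2)\<bar>"
    using zeta_2_ge_1 by (simp add: abs_mult)
  also have "zeta 2 * (?T - 1 / zeta 2) = zeta 2 * ?T - 1"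
    using zeta_2_ge_1 by (simp add: right_diff_distrib)
  finally show ?thesis
    using * by simp
qed

section \<open>Lattice points in half an ellipse\<close>

lemma card_integers_in_interval:
  fixes a b :: real
  assumes "a \<le> b"
  shows "finite {z::int. a \<le> of_int z \<and> of_int z \<le> b}"
    and "\<bar>real (card {z::int. a \<le> of_int z \<and> of_int z \<le> b}) - (b - a)\<bar> \<le> 1"
proof -
  have eq: "{z::int. a \<le> of_int z \<and> of_int z \<le> b} = {\<lceil>a\<rceil>..\<lfloor>b\<rfloor>}"
    by (auto simp: ceiling_le_iff le_floor_iff)
  show "finite {z::int. a \<le> of_int z \<and> of_int z \<le> b}"
    unfolding eq by simp
  have "\<lceil>a\<rceil> \<le> \<lfloor>b\<rfloor> + 1"
    using assms by linarith
  then show "\<bar>real (card {z::int. a \<le> of_int z \<and> of_int z \<le> b}) - (b - a)\<bar> \<le> 1"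
    unfolding eq by simp linarith
qed

text \<open>
The area between abscissae \<open>0\<close> and \<open>x\<close> of the quarter disc of radius \<open>R\<close>, that is, the primitive of
\<open>\<surd>(R\<^sup>2 - x\<^sup>2)\<close> vanishing at \<open>0\<close>.
\<close>
definition disc_area :: "real \<Rightarrow> real \<Rightarrow> real" where
  "disc_area R x = (x * sqrt (R\<^sup>2 - x\<^sup>2) + R\<^sup>2 * arcsin (x / R)) / 2"

lemma disc_area_has_derivative:
  assumes "0 < x" "x < R"
  shows "(disc_area R has_real_derivative sqrt (R\<^sup>2 - x\<^sup>2)) (at x)"
proof -
  have R: "R > 0" and pos: "R\<^sup>2 - x\<^sup>2 > 0"
    using assms by (auto simp: power_strict_mono)
  have "sqrt (1 - (x / R)\<^sup>2) = sqrt ((R\<^sup>2 - x\<^sup>2) / R\<^sup>2)"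
    using R by (simp add: diff_divide_distrib power_divide)
  also have "\<dots> = sqrt (R\<^sup>2 - x\<^sup>2) / R"
    using R by (simp add: real_sqrt_divide)
  finally have s: "sqrt (1 - (x / R)\<^sup>2) = sqrt (R\<^sup>2 - x\<^sup>2) / R" .
  have deriv: "((\<lambda>x. (x * sqrt (R\<^sup>2 - x\<^sup>2) + R\<^sup>2 * arcsin (x / R)) / 2) has_real_derivative
     (sqrt (R\<^sup>2 - x\<^sup>2) + x * (inverse (sqrt (R\<^sup>2 - x\<^sup>2)) / 2 * (- (2 * x))) +
      R\<^sup>2 * (inverse (sqrt (1 - (x / R)\<^sup>2)) * (1 / R))) / 2) (at x)"
    using assms pos by (auto intro!: derivative_eq_intros simp: field_simps)
  have "(sqrt (R\<^sup>2 - x\<^sup>2) + x * (inverse (sqrt (R\<^sup>2 - x\<^sup>2)) / 2 * (- (2 * x))) +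
      R\<^sup>2 * (inverse (sqrt (1 - (x / R)\<^sup>2)) * (1 / R))) / 2 = sqrt (R\<^sup>2 - x\<^sup>2)"
  proof -
    define q where "q = sqrt (R\<^sup>2 - x\<^sup>2)"
    have q: "q > 0" "q * q = R\<^sup>2 - x\<^sup>2"
      using pos by (auto simp: q_def)
    have "(q + x * (inverse q / 2 * (- (2 * x))) + R\<^sup>2 * (inverse (q / R) * (1 / R))) / 2
      = (q * q + (R\<^sup>2 - x\<^sup>2)) / (2 * q)"
      using q R by (simp add: field_simps power2_eq_square)
    also have "\<dots> = q"
      using q by (simp flip: q(2))
    finally show ?thesis
      unfolding s q_def .
  qed
  with deriv show ?thesis
    unfolding disc_area_def[abs_def] by (rule DERIV_cong)
qed

text \<open>
The mean value theorem and monotonicity of \<open>\<surd>(R\<^sup>2 - x\<^sup>2)\<close>. Continuity suffices at the end points, which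
matters at \<open>R\<close>, where the factors \<open>arcsin\<close> and \<open>\<surd>\<close> have no finite derivative.
\<close>
lemma disc_area_increment:
  assumes "0 \<le> x" "x \<le> y" "y \<le> R"
  shows "(y - x) * sqrt (R\<^sup>2 - y\<^sup>2) \<le> disc_area R y - disc_area R x"
    and "disc_area R y - disc_area R x \<le> (y - x) * sqrt (R\<^sup>2 - x\<^sup>2)"
proof -
  have "(y - x) * sqrt (R\<^sup>2 - y\<^sup>2) \<le> disc_area R y - disc_area R x \<and>
    disc_area R y - disc_area R x \<le> (y - x) * sqrt (R\<^sup>2 - x\<^sup>2)"
  proof (cases "x = y")
    case False
    then have xy: "x < y" and R: "R > 0"
      using assms by auto
    have "- 1 \<le> t / R \<and> t / R \<le> 1" if "t \<in> {x..y}" for t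
      using that assms R by (simp add: divide_le_eq le_divide_eq)
    then have cont: "continuous_on {x..y} (disc_area R)"
      unfolding disc_area_def[abs_def] using R
      by (intro continuous_intros continuous_on_arcsin) auto
    have "disc_area R differentiable (at t)" if "x < t" "t < y" for t
      using that assms disc_area_has_derivative[of t R] by (auto simp: real_differentiable_def)
    then obtain l z where z: "x < z" "z < y" "(disc_area R has_real_derivative l) (at z)"
        "disc_area R y - disc_area R x = (y - x) * l"
      using MVT[OF xy cont] by blast
    have "l = sqrt (R\<^sup>2 - z\<^sup>2)"
      using z assms by (intro DERIV_unique[OF z(3)] disc_area_has_derivative) auto
    moreover have "sqrt (R\<^sup>2 - y\<^sup>2) \<le> sqrt (R\<^sup>2 - z\<^sup>2)" "sqrt (R\<^sup>2 - z\<^sup>2) \<le> sqrt (R\<^sup>2 - x\<^sup>2)"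
      using z assms by (auto intro!: power_mono)
    ultimately show ?thesis
      using z(4) xy by (simp add: mult_left_mono)
  qed auto
  then show "(y - x) * sqrt (R\<^sup>2 - y\<^sup>2) \<le> disc_area R y - disc_area R x"
    and "disc_area R y - disc_area R x \<le> (y - x) * sqrt (R\<^sup>2 - x\<^sup>2)"
    by auto
qed

text \<open>
The sum is a Riemann sum of a decreasing function with maximum \<open>R\<close>, so it differs from the area of the
quarter disc by at most \<open>R\<close>.
\<close>
lemma sum_quarter_circle:
  assumes "R \<ge> 0"
  shows "\<bar>(\<Sum>w = 1..nat \<lfloor>R\<rfloor>. sqrt (R\<^sup>2 - (real w)\<^sup>2)) - pi * R\<^sup>2 / 4\<bar> \<le> R"
proof -
  have step: "(\<Sum>w = 1..n. sqrt (R\<^sup>2 - (real w)\<^sup>2)) \<le> disc_area R n \<and>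
    disc_area R n \<le> (\<Sum>w = 1..n. sqrt (R\<^sup>2 - (real w)\<^sup>2)) + R - sqrt (R\<^sup>2 - (real n)\<^sup>2)"
    if "real n \<le> R" for n
    using that
  proof (induction n)
    case 0
    then show ?case
      by (simp add: disc_area_def)
  next
    case (Suc n)
    then show ?case
      using disc_area_increment[of "real n" "real (Suc n)" R] by auto
  qed
  define K where "K = nat \<lfloor>R\<rfloor>"
  have K: "real K \<le> R" "R - real K \<le> 1"
    using assms unfolding K_def by linarith+
  have end_piece: "(R - real K) * sqrt (R\<^sup>2 - R\<^sup>2) \<le> disc_area R R - disc_area R K"
      "disc_area R R - disc_area R K \<le> (R - real K) * sqrt (R\<^sup>2 - (real K)\<^sup>2)"
    using K by (intro disc_area_increment; simp)+
  have "(R - real K) * sqrt (R\<^sup>2 - (real K)\<^sup>2) \<le> 1 * sqrt (R\<^sup>2 - (real K)\<^sup>2)"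
    using K by (intro mult_right_mono) (auto intro!: power_mono)
  moreover have "disc_area R R = pi * R\<^sup>2 / 4"
    by (cases "R = 0") (auto simp: disc_area_def)
  ultimately show ?thesis
    using step[OF K(1)] end_piece unfolding K_def by auto
qed

definition half_ellipse :: "real \<Rightarrow> real \<Rightarrow> real \<Rightarrow> real \<Rightarrow> (int \<times> int) set" where
  "half_ellipse a b d X =
     {(w, z). 0 < w \<and> a * (of_int w)\<^sup>2 + 2 * b * of_int w * of_int z + d * (of_int z)\<^sup>2 \<le> X\<^sup>2}"

text \<open>
Completing the square, \<open>d (a w\<^sup>2 + 2 b w z + d z\<^sup>2) = (d z + b w)\<^sup>2 + (a d - b\<^sup>2) w\<^sup>2\<close>, shows that for fixed \<open>w\<close> the
admissible \<open>z\<close> fill an interval with half-length \<open>s w / d\<close>, and that no \<open>w > R\<close> occurs.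
\<close>
lemma half_ellipse_rows:
  fixes a b d X :: real
  assumes d: "d > 0" and disc: "a * d - b\<^sup>2 > 0" and X: "X \<ge> 0"
  defines "R \<equiv> X * sqrt (d / (a * d - b\<^sup>2))"
  defines "s \<equiv> \<lambda>w. sqrt (a * d - b\<^sup>2) * sqrt (R\<^sup>2 - (of_int w)\<^sup>2)"
  shows "half_ellipse a b d X = (SIGMA w:{1..\<lfloor>R\<rfloor>}.
    {z. (- b * of_int w - s w) / d \<le> of_int z \<and> of_int z \<le> (- b * of_int w + s w) / d})"
proof -
  define D where "D = a * d - b\<^sup>2"
  have D: "D > 0"
    using disc by (simp add: D_def)
  have R0: "R \<ge> 0" and R2: "D * R\<^sup>2 = d * X\<^sup>2"
    using X d D by (auto simp: R_def power_mult_distrib D_def)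
  have mem: "(w, z) \<in> half_ellipse a b d X \<longleftrightarrow> w \<in> {1..\<lfloor>R\<rfloor>} \<and>
      (- b * of_int w - s w) / d \<le> of_int z \<and> of_int z \<le> (- b * of_int w + s w) / d" for w z :: int
  proof -
    define x y where "x = (of_int w :: real)" and "y = (of_int z :: real)"
    have "a * x\<^sup>2 + 2 * b * x * y + d * y\<^sup>2 \<le> X\<^sup>2 \<longleftrightarrow>
        d * (a * x\<^sup>2 + 2 * b * x * y + d * y\<^sup>2) \<le> d * X\<^sup>2"
      using d by simp
    also have "d * (a * x\<^sup>2 + 2 * b * x * y + d * y\<^sup>2) = (d * y + b * x)\<^sup>2 + D * x\<^sup>2"
      by (simp add: D_def power2_eq_square algebra_simps)
    also have "\<dots> \<le> d * X\<^sup>2 \<longleftrightarrow> (d * y + b * x)\<^sup>2 \<le> D * (R\<^sup>2 - x\<^sup>2)"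
      by (simp add: R2[symmetric] algebra_simps)
    finally have iff1: "a * x\<^sup>2 + 2 * b * x * y + d * y\<^sup>2 \<le> X\<^sup>2 \<longleftrightarrow> (d * y + b * x)\<^sup>2 \<le> D * (R\<^sup>2 - x\<^sup>2)" .
    show ?thesis
    proof (cases "0 < w \<and> x \<le> R")
      case True
      then have w: "w \<in> {1..\<lfloor>R\<rfloor>}" "0 < w"
        by (auto simp: x_def le_floor_iff)
      have nn: "R\<^sup>2 - x\<^sup>2 \<ge> 0"
        using True by (auto simp: x_def intro!: power_mono)
      have "(s w)\<^sup>2 = D * (R\<^sup>2 - x\<^sup>2)" and s0: "s w \<ge> 0"
        using nn D by (auto simp: s_def D_def x_def power_mult_distrib)
      then have "(d * y + b * x)\<^sup>2 \<le> D * (R\<^sup>2 - x\<^sup>2) \<longleftrightarrow> \<bar>d * y + b * x\<bar> \<le> s w"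
        by (metis abs_le_square_iff abs_of_nonneg)
      also have "\<dots> \<longleftrightarrow> (- b * x - s w) / d \<le> y \<and> y \<le> (- b * x + s w) / d"
        using d by (auto simp: divide_le_eq le_divide_eq abs_le_iff algebra_simps)
      finally show ?thesis
        using iff1 w by (simp add: half_ellipse_def x_def y_def)
    next
      case False
      have "\<not> (d * y + b * x)\<^sup>2 \<le> D * (R\<^sup>2 - x\<^sup>2)" if "0 < w"
      proof
        assume "(d * y + b * x)\<^sup>2 \<le> D * (R\<^sup>2 - x\<^sup>2)"
        then have "0 \<le> D * (R\<^sup>2 - x\<^sup>2)"
          by (rule order_trans[OF zero_le_power2])
        then have "x\<^sup>2 \<le> R\<^sup>2"
          using D by (simp add: zero_le_mult_iff)
        then have "x \<le> R"
          using R0 by (rule power2_le_imp_le)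
        with False that show False
          by simp
      qed
      then show ?thesis
        using iff1 False by (auto simp: half_ellipse_def x_def y_def le_floor_iff)
    qed
  qed
  then show ?thesis
    by (intro set_eqI) (simp add: split_paired_all)
qed

lemma finite_half_ellipse:
  assumes "d > 0" "a * d - b\<^sup>2 > 0" "X \<ge> 0"
  shows "finite (half_ellipse a b d X)"
proof -
  have "finite {z::int. u \<le> of_int z \<and> of_int z \<le> v}" for u v :: real
    by (rule finite_subset[of _ "{\<lceil>u\<rceil>..\<lfloor>v\<rfloor>}"]) (auto simp: ceiling_le_iff le_floor_iff)
  then show ?thesis
    unfolding half_ellipse_rows[OF assms] by (intro finite_SigmaI) auto
qed

lemma half_ellipse_fst_le:
  assumes "d > 0" "a * d - b\<^sup>2 > 0" "X \<ge> 0" "(w, z) \<in> half_ellipse a b d X"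
  shows "0 < w \<and> w \<le> \<lfloor>X * sqrt (d / (a * d - b\<^sup>2))\<rfloor>"
  using assms(4) unfolding half_ellipse_rows[OF assms(1-3)] by auto

text \<open>
Each of the at most \<open>R\<close> rows is counted with error 1, and the row lengths are, up to the factor
\<open>2 \<surd>(a d - b\<^sup>2) / d\<close>, the terms of \<open>sum_quarter_circle\<close>. The estimate holds for all \<open>X \<ge> 0\<close>, even when
there are no rows, and this uniformity is what allows it to be summed over \<open>X / k\<close> below.
\<close>
lemma card_half_ellipse:
  fixes a b d X :: real
  assumes d: "d > 0" and disc: "a * d - b\<^sup>2 > 0" and X: "X \<ge> 0"
  shows "\<bar>real (card (half_ellipse a b d X)) - pi * X\<^sup>2 / (2 * sqrt (a * d - b\<^sup>2))\<bar>
    \<le> X * (sqrt (d / (a * d - b\<^sup>2)) + 2 / sqrt d)"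
proof -
  define D where "D = a * d - b\<^sup>2"
  define R where "R = X * sqrt (d / D)"
  define s where "s = (\<lambda>w::int. sqrt D * sqrt (R\<^sup>2 - (of_int w)\<^sup>2))"
  define row where "row = (\<lambda>w. {z::int. (- b * of_int w - s w) / d \<le> of_int z \<and> of_int z \<le> (- b * of_int w + s w) / d})"
  have D: "D > 0"
    using disc by (simp add: D_def)
  have R0: "R \<ge> 0"
    using X d D by (auto simp: R_def)
  have rows: "half_ellipse a b d X = (SIGMA w:{1..\<lfloor>R\<rfloor>}. row w)"
    using half_ellipse_rows[OF assms] unfolding row_def s_def R_def D_def .
  have row: "finite (row w)" "\<bar>real (card (row w)) - 2 * s w / d\<bar> \<le> 1" if "w \<in> {1..\<lfloor>R\<rfloor>}" for w
  proof -
    have "real_of_int w \<le> R"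
      using that by (simp add: le_floor_iff)
    then have "s w \<ge> 0"
      using that D by (auto simp: s_def intro!: power_mono mult_nonneg_nonneg)
    then have le: "(- b * of_int w - s w) / d \<le> (- b * of_int w + s w) / d"
      using d by (intro divide_right_mono) auto
    have len: "(- b * of_int w + s w) / d - (- b * of_int w - s w) / d = 2 * s w / d"
      by (simp add: diff_divide_distrib[symmetric])
    show "finite (row w)" "\<bar>real (card (row w)) - 2 * s w / d\<bar> \<le> 1"
      using card_integers_in_interval[OF le] unfolding row_def len by auto
  qed
  have "real (card (half_ellipse a b d X)) = (\<Sum>w = 1..\<lfloor>R\<rfloor>. real (card (row w)))"
    unfolding rows by (subst card_SigmaI) (use row in auto)
  then have "\<bar>real (card (half_ellipse a b d X)) - (\<Sum>w = 1..\<lfloor>R\<rfloor>. 2 * s w / d)\<bar> =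
      \<bar>\<Sum>w = 1..\<lfloor>R\<rfloor>. real (card (row w)) - 2 * s w / d\<bar>"
    by (simp add: sum_subtractf)
  also have "\<dots> \<le> (\<Sum>w = 1..\<lfloor>R\<rfloor>. 1)"
    by (rule order_trans[OF sum_abs sum_mono]) (use row in auto)
  also have "\<dots> \<le> R"
    using R0 by simp
  finally have 1: "\<bar>real (card (half_ellipse a b d X)) - (\<Sum>w = 1..\<lfloor>R\<rfloor>. 2 * s w / d)\<bar> \<le> R" .
  have "(\<Sum>w = 1..\<lfloor>R\<rfloor>. 2 * s w / d) = (\<Sum>w = 1..nat \<lfloor>R\<rfloor>. 2 * s (int w) / d)"
    by (rule sum.reindex_bij_witness[of _ int nat]) auto
  also have "\<dots> = 2 * sqrt D / d * (\<Sum>w = 1..nat \<lfloor>R\<rfloor>. sqrt (R\<^sup>2 - (real w)\<^sup>2))"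
    by (simp add: s_def sum_distrib_left mult_ac)
  finally have 2: "(\<Sum>w = 1..\<lfloor>R\<rfloor>. 2 * s w / d) =
      2 * sqrt D / d * (\<Sum>w = 1..nat \<lfloor>R\<rfloor>. sqrt (R\<^sup>2 - (real w)\<^sup>2))" .
  have "\<bar>(\<Sum>w = 1..\<lfloor>R\<rfloor>. 2 * s w / d) - 2 * sqrt D / d * (pi * R\<^sup>2 / 4)\<bar> =
    2 * sqrt D / d * \<bar>(\<Sum>w = 1..nat \<lfloor>R\<rfloor>. sqrt (R\<^sup>2 - (real w)\<^sup>2)) - pi * R\<^sup>2 / 4\<bar>"
    unfolding 2 right_diff_distrib[symmetric] abs_mult using d D by simp
  also have "\<dots> \<le> 2 * sqrt D / d * R"
    using sum_quarter_circle[OF R0] d D by (intro mult_left_mono) auto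
  finally have 3: "\<bar>(\<Sum>w = 1..\<lfloor>R\<rfloor>. 2 * s w / d) - 2 * sqrt D / d * (pi * R\<^sup>2 / 4)\<bar> \<le> 2 * sqrt D / d * R" .
  have 4: "2 * sqrt D / d * R = 2 * X / sqrt d"
    using d D by (simp add: R_def real_sqrt_divide field_simps)
  have "2 * sqrt D / d * (pi * R\<^sup>2 / 4) = pi * X\<^sup>2 * (sqrt D / (2 * D))"
    using d D by (simp add: R_def power_mult_distrib)
  also have "\<dots> = pi * X\<^sup>2 / (2 * sqrt D)"
    using D by (simp add: field_simps flip: power2_eq_square)
  finally have 5: "2 * sqrt D / d * (pi * R\<^sup>2 / 4) = pi * X\<^sup>2 / (2 * sqrt D)" .
  have "\<bar>real (card (half_ellipse a b d X)) - pi * X\<^sup>2 / (2 * sqrt D)\<bar> \<le> R + 2 * X / sqrt d"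
    using 1 3 unfolding 4 5 by linarith
  then show ?thesis
    by (simp add: R_def D_def distrib_left)
qed

lemma card_multiples_half_ellipse:
  assumes "k > 0"
  shows "card {(w, z) \<in> half_ellipse a b d X. int k dvd w \<and> int k dvd z} =
    card (half_ellipse a b d (X / real k))"
proof -
  have mem: "(int k * w, int k * z) \<in> half_ellipse a b d X \<longleftrightarrow> (w, z) \<in> half_ellipse a b d (X / real k)"
    for w z
  proof -
    define Q where "Q = a * (of_int w)\<^sup>2 + 2 * b * of_int w * of_int z + d * (of_int z)\<^sup>2"
    have "a * (real k * of_int w)\<^sup>2 + 2 * b * (real k * of_int w) * (real k * of_int z) +
        d * (real k * of_int z)\<^sup>2 = (real k)\<^sup>2 * Q"
      by (simp add: Q_def power2_eq_square algebra_simps)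
    moreover have "(real k)\<^sup>2 * Q \<le> X\<^sup>2 \<longleftrightarrow> Q \<le> (X / real k)\<^sup>2"
      using assms by (simp add: power_divide field_simps)
    ultimately show ?thesis
      using assms by (simp add: half_ellipse_def Q_def zero_less_mult_iff)
  qed
  have "{(w, z) \<in> half_ellipse a b d X. int k dvd w \<and> int k dvd z} =
      (\<lambda>(w, z). (int k * w, int k * z)) ` half_ellipse a b d (X / real k)"
  proof (intro set_eqI iffI)
    fix v
    assume "v \<in> {(w, z) \<in> half_ellipse a b d X. int k dvd w \<and> int k dvd z}"
    then obtain w z where v: "v = (int k * w, int k * z)" "v \<in> half_ellipse a b d X"
      by (auto elim!: dvdE)
    then have "(w, z) \<in> half_ellipse a b d (X / real k)"
      using mem by simp
    then show "v \<in> (\<lambda>(w, z). (int k * w, int k * z)) ` half_ellipse a b d (X / real k)"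
      using v by (intro image_eqI[of _ _ "(w, z)"]) auto
  qed (use mem in auto)
  moreover have "inj_on (\<lambda>(w, z). (int k * w, int k * z)) A" for A
    using assms by (auto simp: inj_on_def)
  ultimately show ?thesis
    by (simp add: card_image)
qed

text \<open>
Moebius inversion only involves \<open>k \<le> K = \<lfloor>R\<rfloor>\<close>, because the ellipse shrunk by \<open>k > R\<close> has no row. Summing
the errors of \<open>card_half_ellipse\<close> gives a harmonic sum, and truncating \<open>\<Sum> \<mu>(k) / k\<^sup>2\<close> at \<open>K\<close> costs
\<open>O(log K / K)\<close> times the main term, which is of order \<open>R X / \<surd>d\<close>. If \<open>K = 0\<close> nothing is counted and
the main term itself is within the bound. The parameter \<open>Y\<close> stands in for \<open>R\<close> in the
logarithm so that one logarithm can serve for all lines.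
\<close>
lemma card_coprime_half_ellipse:
  fixes a b d X Y :: real
  assumes d: "d > 0" and disc: "a * d - b\<^sup>2 > 0" and X: "X \<ge> 0"
    and Y: "X * sqrt (d / (a * d - b\<^sup>2)) \<le> Y" "1 \<le> Y"
  shows "\<bar>real (card {(w, z) \<in> half_ellipse a b d X. coprime w z})
      - pi * X\<^sup>2 / (2 * zeta 2 * sqrt (a * d - b\<^sup>2))\<bar>
    \<le> X * (1 + ln Y) * (sqrt (d / (a * d - b\<^sup>2)) + (2 + 2 * pi) / sqrt d)"
proof -
  define D where "D = a * d - b\<^sup>2"
  define R where "R = X * sqrt (d / D)"
  define K where "K = nat \<lfloor>R\<rfloor>"
  define M where "M = pi * X\<^sup>2 / (2 * sqrt D)"
  define E where "E = sqrt (d / D) + 2 / sqrt d"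
  let ?P = "{(w, z) \<in> half_ellipse a b d X. coprime w z}"
  have D: "D > 0"
    using disc by (simp add: D_def)
  have R0: "R \<ge> 0" and M0: "M \<ge> 0" and E0: "E \<ge> 0"
    using X d D by (auto simp: R_def M_def E_def)
  have M_eq: "M = R * (pi * X / (2 * sqrt d))"
    using d D by (simp add: R_def M_def real_sqrt_divide power2_eq_square mult_ac)
  have dX: "pi * X / (2 * sqrt d) \<ge> 0"
    using d X by simp
  have lnY: "0 \<le> ln Y"
    using Y by simp
  have K: "real K \<le> R" "R < real K + 1"
    using R0 unfolding K_def by linarith+
  have S: "finite (half_ellipse a b d X)" "\<And>w z. (w, z) \<in> half_ellipse a b d X \<Longrightarrow> 0 < w \<and> w \<le> int K"
    using finite_half_ellipse[OF assms(1-3)] half_ellipse_fst_le[OF assms(1-3)] R0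
    by (auto simp: K_def R_def D_def)
  have "real (card ?P) = (\<Sum>k = 1..K. moebius k * real (card {(w, z) \<in> half_ellipse a b d X. int k dvd w \<and> int k dvd z}))"
    using S by (rule card_coprime_pairs)
  also have "\<dots> = (\<Sum>k = 1..K. moebius k * real (card (half_ellipse a b d (X / real k))))"
    by (intro sum.cong refl) (subst card_multiples_half_ellipse, auto)
  finally have P: "real (card ?P) = (\<Sum>k = 1..K. moebius k * real (card (half_ellipse a b d (X / real k))))" .
  have main: "\<bar>real (card ?P) - M / zeta 2\<bar> \<le> X * (1 + ln Y) * (E + 2 * pi / sqrt d)"
  proof (cases "K \<ge> 1")
    case True
    have lnK: "1 + ln (real K) \<le> 1 + ln Y"
      using True K Y by (simp add: R_def D_def)
    have "\<bar>real (card ?P) - M * (\<Sum>k = 1..K. moebius k / real k ^ 2)\<bar> =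
      \<bar>\<Sum>k = 1..K. moebius k * (real (card (half_ellipse a b d (X / real k))) - M / real k ^ 2)\<bar>"
      unfolding P by (simp add: sum_distrib_left sum_subtractf algebra_simps)
    also have "\<dots> \<le> (\<Sum>k = 1..K. X * E * (1 / real k))"
    proof (rule order_trans[OF sum_abs sum_mono])
      fix k assume k: "k \<in> {1..K}"
      have "\<bar>real (card (half_ellipse a b d (X / real k))) - M / real k ^ 2\<bar> \<le> X * E * (1 / real k)"
        using card_half_ellipse[OF d disc, of "X / real k"] X
        by (simp add: M_def E_def D_def power_divide mult.commute)
      then show "\<bar>moebius k * (real (card (half_ellipse a b d (X / real k))) - M / real k ^ 2)\<bar>
        \<le> X * E * (1 / real k)"
        unfolding abs_mult using abs_moebius_le_1[of k]
        by (intro order_trans[OF mult_left_le_one_le]) auto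
    qed
    also have "\<dots> = X * E * (\<Sum>k = 1..K. 1 / real k)"
      by (simp add: sum_distrib_left)
    also have "\<dots> \<le> X * E * (1 + ln Y)"
      using sum_inverse_le_ln[OF True] lnK X E0 by (intro mult_left_mono) auto
    finally have 1: "\<bar>real (card ?P) - M * (\<Sum>k = 1..K. moebius k / real k ^ 2)\<bar> \<le> X * E * (1 + ln Y)" .
    have "M * \<bar>(\<Sum>k = 1..K. moebius k / real k ^ 2) - 1 / zeta 2\<bar> \<le> M * (2 * (1 + ln (real K)) / real K)"
      using sum_moebius_over_squares[OF True] M0 by (rule mult_left_mono)
    also have "\<dots> = R / real K * (pi * X / (2 * sqrt d)) * 2 * (1 + ln (real K))"
      unfolding M_eq by (simp only: times_divide_eq_left times_divide_eq_right divide_divide_eq_left mult_ac)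
    also have "\<dots> \<le> 2 * (pi * X / (2 * sqrt d)) * 2 * (1 + ln Y)"
    proof (intro mult_mono)
      show "R / real K \<le> 2"
        using K True by (simp add: divide_le_eq)
    qed (use lnK lnY X d D True R0 in auto)
    finally have "M * \<bar>(\<Sum>k = 1..K. moebius k / real k ^ 2) - 1 / zeta 2\<bar> \<le> 2 * (pi * X / (2 * sqrt d)) * 2 * (1 + ln Y)" .
    then have "\<bar>M * (\<Sum>k = 1..K. moebius k / real k ^ 2) - M / zeta 2\<bar> \<le> 2 * (pi * X / (2 * sqrt d)) * 2 * (1 + ln Y)"
      using M0 abs_mult[of M "(\<Sum>k = 1..K. moebius k / real k ^ 2) - 1 / zeta 2"]
      by (simp add: right_diff_distrib)
    also have "\<dots> = X * (1 + ln Y) * (2 * pi / sqrt d)"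
      by simp
    finally show ?thesis
      using 1 by (simp add: algebra_simps)
  next
    case False
    then have "K = 0"
      by simp
    then have "real (card ?P) = 0" and R1: "R \<le> 1"
      using P K by auto
    have "M / zeta 2 \<le> M / 1"
      using M0 zeta_2_ge_1 by (intro divide_left_mono) auto
    also have "M / 1 \<le> 1 * (pi * X / (2 * sqrt d))"
      unfolding M_eq div_by_1 using R1 dX by (rule mult_right_mono)
    also have "\<dots> \<le> X * 1 * (0 + 2 * pi / sqrt d)"
      using X d by (simp add: field_simps)
    also have "\<dots> \<le> X * (1 + ln Y) * (E + 2 * pi / sqrt d)"
      using X d E0 lnY by (intro mult_mono add_mono) auto
    finally show ?thesis
      using \<open>real (card ?P) = 0\<close> M0 zeta_2_ge_1 by simp
  qed
  have "M / zeta 2 = pi * X\<^sup>2 / (2 * zeta 2 * sqrt D)"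
    by (simp add: M_def mult_ac)
  moreover have "E + 2 * pi / sqrt d = sqrt (d / D) + (2 + 2 * pi) / sqrt d"
    by (simp add: E_def add_divide_distrib)
  ultimately show ?thesis
    using main by (simp add: D_def)
qed

section \<open>Heights of projective points\<close>

lemma Gcd_range_dvd: "Gcd (range (\<lambda>i. v $ i)) dvd (v $ i :: int)"
  by (intro Gcd_dvd) auto

text \<open>
Write the factor as \<open>a / b\<close>. The greatest common divisors of the coordinates of \<open>b t = a s\<close> are \<open>|b|\<close> and
\<open>|a|\<close>, so the factor is \<open>1\<close> or \<open>-1\<close>.
\<close>
lemma primitive_proportional_eq_or_neg:
  fixes s t :: "int ^ 'n"
  assumes s: "s \<in> primitive_vectors" and t: "t \<in> primitive_vectors"
    and c: "\<And>i. rat_of_int (t $ i) = c * rat_of_int (s $ i)"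
  shows "t = s \<or> t = - s"
proof -
  obtain a b where ab: "quotient_of c = (a, b)"
    by force
  then have b: "b > 0" and cab: "c = rat_of_int a / rat_of_int b"
    by (auto dest: quotient_of_denom_pos quotient_of_div)
  have eq: "b * t $ i = a * s $ i" for i
  proof -
    have "rat_of_int (b * t $ i) = rat_of_int (a * s $ i)"
      using b by (simp add: c cab)
    then show ?thesis
      by (simp only: of_int_eq_iff)
  qed
  have Gcd_scale: "Gcd (range (\<lambda>i. x * v $ i)) = \<bar>x\<bar> * Gcd (range (\<lambda>i. v $ i))" for x :: int and v :: "int ^ 'n"
    using Gcd_mult[of x "range (\<lambda>i. v $ i)"] by (simp add: image_image abs_mult)
  have "\<bar>b\<bar> * Gcd (range (\<lambda>i. t $ i)) = Gcd (range (\<lambda>i. a * s $ i))"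
    unfolding Gcd_scale[symmetric] by (simp only: eq)
  also have "\<dots> = \<bar>a\<bar> * Gcd (range (\<lambda>i. s $ i))"
    by (rule Gcd_scale)
  finally have "\<bar>b\<bar> = \<bar>a\<bar>"
    using s t by (simp add: primitive_vectors_def)
  then have "a = b \<or> a = - b"
    using b by auto
  then show ?thesis
  proof
    assume "a = b"
    then have "t = s"
      using eq b by (simp add: vec_eq_iff)
    then show ?thesis ..
  next
    assume a: "a = - b"
    have "t $ i = - s $ i" for i
    proof -
      have "b * t $ i = b * (- s $ i)"
        using eq[of i] by (simp add: a)
      then show ?thesis
        using b by (simp only: mult_cancel_left) auto
    qed
    then have "t = - s"
      by (simp add: vec_eq_iff)
    then show ?thesis ..
  qed
qed

abbreviation to_rat :: "int ^ 'n \<Rightarrow> rat ^ 'n" where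
  "to_rat t \<equiv> (\<chi> i. of_int (t $ i))"

lemma proportional_equiv: "equiv (UNIV - {0}) proportional"
proof (rule equivI)
  show "refl_on (UNIV - {0}) proportional"
    by (rule refl_onI) (auto simp: proportional_def intro!: exI[of _ 1])
  show "sym proportional"
  proof (rule symI)
    fix x y :: "rat ^ 'n"
    assume "(x, y) \<in> proportional"
    then obtain c where "x \<noteq> 0" "y \<noteq> 0" "c \<noteq> 0" "y = c *s x"
      by (auto simp: proportional_def)
    then show "(y, x) \<in> proportional"
      by (auto simp: proportional_def intro!: exI[of _ "inverse c"])
  qed
  show "trans proportional"
  proof (rule transI)
    fix x y z :: "rat ^ 'n"
    assume "(x, y) \<in> proportional" "(y, z) \<in> proportional"
    then obtain c d where "x \<noteq> 0" "z \<noteq> 0" "c \<noteq> 0" "d \<noteq> 0" "y = c *s x" "z = d *s y"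
      by (auto simp: proportional_def)
    then show "(x, z) \<in> proportional"
      by (auto simp: proportional_def vector_smult_assoc intro!: exI[of _ "d * c"])
  qed
  show "proportional \<subseteq> (UNIV - {0}) \<times> (UNIV - {0})"
    by (auto simp: proportional_def)
qed

definition proj_class :: "rat ^ 'n \<Rightarrow> (rat ^ 'n) set" where
  "proj_class x = proportional `` {x}"

lemma mem_proj_class: "x \<noteq> 0 \<Longrightarrow> y \<in> proj_class x \<longleftrightarrow> (\<exists>c. c \<noteq> 0 \<and> y = c *s x)"
  by (auto simp: proj_class_def proportional_def)

lemma proj_class_in_projective_points: "x \<noteq> 0 \<Longrightarrow> proj_class x \<in> projective_points"
  by (auto simp: proj_class_def projective_points_def intro: quotientI)

lemma projective_points_cases:
  assumes "P \<in> projective_points"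
  obtains x where "x \<noteq> 0" "P = proj_class x"
  using assms by (auto simp: proj_class_def projective_points_def elim!: quotientE)

lemma proj_class_eq_iff:
  assumes "x \<noteq> 0" "y \<noteq> 0"
  shows "proj_class x = proj_class y \<longleftrightarrow> (\<exists>c. c \<noteq> 0 \<and> y = c *s x)"
proof -
  have "proj_class x = proj_class y \<longleftrightarrow> (x, y) \<in> proportional"
    unfolding proj_class_def using assms by (intro eq_equiv_class_iff[OF proportional_equiv]) auto
  then show ?thesis
    using assms by (simp add: proportional_def)
qed

lemma primitive_nonzero:
  assumes "t \<in> primitive_vectors"
  shows "to_rat t \<noteq> 0"
proof
  assume "to_rat t = 0"
  then have "range (\<lambda>i. t $ i) \<subseteq> {0}"
    by (auto simp: vec_eq_iff)
  then have "Gcd (range (\<lambda>i. t $ i)) = 0"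
    by (simp add: Gcd_0_iff)
  with assms show False
    by (simp add: primitive_vectors_def)
qed

text \<open>
By the preceding uniqueness up to sign the description defining the height has exactly one solution.
\<close>
lemma height_primitive:
  assumes "t \<in> primitive_vectors"
  shows "height (proj_class (to_rat t)) = norm (\<chi> i. real_of_int (t $ i))"
  unfolding height_def
proof (rule the_equality)
  show "\<exists>s\<in>primitive_vectors. to_rat s \<in> proj_class (to_rat t) \<and>
      norm (\<chi> i. real_of_int (t $ i)) = norm (\<chi> i. real_of_int (s $ i))"
    using assms primitive_nonzero[OF assms]
    by (intro bexI[of _ t]) (auto simp: mem_proj_class intro!: exI[of _ 1])
next
  fix h
  assume "\<exists>s\<in>primitive_vectors. to_rat s \<in> proj_class (to_rat t) \<and> h = norm (\<chi> i. real_of_int (s $ i))"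
  then obtain s c where s: "s \<in> primitive_vectors" "to_rat s = c *s to_rat t" "h = norm (\<chi> i. real_of_int (s $ i))"
    using primitive_nonzero[OF assms] by (auto simp: mem_proj_class)
  have "s = t \<or> s = - t"
    using assms s(1)
  proof (rule primitive_proportional_eq_or_neg)
    show "rat_of_int (s $ i) = c * rat_of_int (t $ i)" for i
      using s(2) by (simp add: vec_eq_iff)
  qed
  moreover have "(\<chi> i. real_of_int ((- t) $ i)) = - (\<chi> i. real_of_int (t $ i))"
    by (simp add: vec_eq_iff)
  ultimately show "h = norm (\<chi> i. real_of_int (t $ i))"
    using s(3) by (metis norm_minus_cancel)
qed

section \<open>Parametrization by the ruling\<close>

definition vec4 :: "'a \<Rightarrow> 'a \<Rightarrow> 'a \<Rightarrow> 'a \<Rightarrow> 'a ^ 4" where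
  "vec4 a b c d = (\<chi> i. if i = 0 then a else if i = 1 then b else if i = 2 then c else d)"

lemma vec4_nth [simp]:
  "vec4 a b c d $ 0 = a" "vec4 a b c d $ 1 = b" "vec4 a b c d $ 2 = c" "vec4 a b c d $ 3 = d"
  by (simp_all add: vec4_def)

text \<open>
In the index type \<open>4\<close> the numeral \<open>4\<close> equals \<open>0\<close>, so these are the library facts with the coordinates
numbered from 0.
\<close>
lemma forall_index_4: "(\<forall>i::4. P i) \<longleftrightarrow> P 0 \<and> P 1 \<and> P 2 \<and> P 3"
proof -
  have "(4::4) = 0"
    by simp
  then show ?thesis
    unfolding forall_4 by (simp only:) blast
qed

lemma sum_index_4: "sum f (UNIV :: 4 set) = f 0 + f 1 + f 2 + f 3"
proof -
  have "(4::4) = 0"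
    by simp
  then show ?thesis
    unfolding sum_4 by (simp only:) (simp only: add_ac)
qed

text \<open>
The general integer vector in the plane over the line \<open>(l, m)\<close>: the combination with coefficients \<open>w\<close>
and \<open>z\<close> of the basis vectors \<open>(m\<^sup>2, l m, l\<^sup>2, 0)\<close> and \<open>(0, 0, m, l)\<close>. The second one lies on the double line.
\<close>
definition ruling_point :: "int \<times> int \<Rightarrow> int \<times> int \<Rightarrow> int ^ 4" where
  "ruling_point = (\<lambda>(l, m) (w, z). vec4 (m\<^sup>2 * w) (l * m * w) (l\<^sup>2 * w + m * z) (l * z))"

text \<open>
A common prime divisor \<open>p\<close> of the coordinates divides \<open>w\<close> and \<open>z\<close>: if \<open>p\<close> divides \<open>m\<close>, it does not divide \<open>l\<close>, and
the last two coordinates give the claim; otherwise the first and the third do.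
\<close>
lemma ruling_point_primitive:
  assumes "coprime l m" "coprime w z" "0 < m" "0 < w"
  shows "ruling_point (l, m) (w, z) \<in> primitive_vectors"
proof (rule ccontr)
  let ?t = "ruling_point (l, m) (w, z)"
  let ?g = "Gcd (range (\<lambda>i. ?t $ i))"
  assume "?t \<notin> primitive_vectors"
  then have "?g \<noteq> 1"
    by (simp add: primitive_vectors_def)
  moreover have "?g \<ge> 0"
    by simp
  moreover have "?g \<noteq> 0"
  proof -
    have "?g dvd m\<^sup>2 * w"
      using Gcd_range_dvd[of ?t 0] by (simp add: ruling_point_def)
    moreover have "m\<^sup>2 * w \<noteq> 0"
      using assms by simp
    ultimately show ?thesis
      by (metis dvd_0_left)
  qed
  ultimately obtain p where p: "prime p" "p dvd ?g"
    by (metis abs_of_nonneg prime_factor_int)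
  then have dvd: "p dvd ?t $ i" for i
    using Gcd_range_dvd dvd_trans by blast
  have p0: "p dvd m\<^sup>2 * w" and p2: "p dvd l\<^sup>2 * w + m * z" and p3: "p dvd l * z"
    using dvd[of 0] dvd[of 2] dvd[of 3] by (simp_all add: ruling_point_def)
  have "p dvd w \<and> p dvd z"
  proof (cases "p dvd m")
    case True
    then have "\<not> p dvd l"
      using assms(1) p(1) by (meson coprime_common_divisor not_prime_unit)
    moreover have "p dvd l\<^sup>2 * w"
      using p2 True by (metis dvd_add_left_iff dvd_mult2)
    ultimately show ?thesis
      using p(1) p3 by (auto simp: prime_dvd_mult_iff prime_dvd_power_iff)
  next
    case False
    then have "p dvd w"
      using p0 p(1) by (auto simp: prime_dvd_mult_iff prime_dvd_power_iff)
    then have "p dvd m * z"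
      using p2 by (metis dvd_add_right_iff dvd_mult)
    with \<open>p dvd w\<close> False show ?thesis
      using p(1) by (auto simp: prime_dvd_mult_iff)
  qed
  then show False
    using assms(2) p(1) by (meson coprime_common_divisor not_prime_unit)
qed

definition point_parameters :: "((int \<times> int) \<times> (int \<times> int)) set" where
  "point_parameters = {((l, m), (w, z)). 0 < m \<and> coprime l m \<and> 0 < w \<and> coprime w z}"

definition cayley_point :: "(int \<times> int) \<times> (int \<times> int) \<Rightarrow> (rat ^ 4) set" where
  "cayley_point = (\<lambda>(p, q). proj_class (to_rat (ruling_point p q)))"

lemma coprime_fraction_unique:
  fixes l m l' m' :: int
  assumes "0 < m" "0 < m'" "coprime l m" "coprime l' m'"
    and "rat_of_int l / rat_of_int m = rat_of_int l' / rat_of_int m'"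
  shows "l = l' \<and> m = m'"
proof -
  have "quotient_of (rat_of_int l / rat_of_int m) = (l, m)" if "0 < m" "coprime l m" for l m
    using that by (simp add: Fract_of_int_quotient[symmetric] quotient_of_Fract normalize_stable)
  from this[OF assms(1,3)] this[OF assms(2,4)] have "(l, m) = (l', m')"
    unfolding assms(5) by (rule trans[OF sym])
  then show ?thesis
    by simp
qed

lemma fraction_coprime:
  obtains l m :: int where "0 < m" "coprime l m" "x = rat_of_int l / rat_of_int m"
proof (cases "quotient_of x")
  case (Pair l m)
  then show ?thesis
    by (intro that[of m l] quotient_of_denom_pos quotient_of_coprime quotient_of_div)
qed

text \<open>
The ratio \<open>t\<^sub>1 / t\<^sub>0 = l / m\<close> recovers \<open>(l, m)\<close>. Then \<open>t\<^sub>2 / t\<^sub>0 = (l\<^sup>2 + m z / w) / m\<^sup>2\<close> recovers \<open>z / w\<close> and hence \<open>(w, z)\<close>.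
\<close>
lemma inj_on_cayley_point: "inj_on cayley_point point_parameters"
proof (rule inj_onI)
  fix u v
  assume u: "u \<in> point_parameters" and v: "v \<in> point_parameters" and eq: "cayley_point u = cayley_point v"
  obtain l m w z where u': "u = ((l, m), (w, z))" "0 < m" "0 < w" "coprime l m" "coprime w z"
    using u by (auto simp: point_parameters_def)
  obtain l' m' w' z' where v': "v = ((l', m'), (w', z'))"
      "0 < m'" "0 < w'" "coprime l' m'" "coprime w' z'"
    using v by (auto simp: point_parameters_def)
  note pos = u'(2,3) v'(2,3) and cop = u'(4,5) v'(4,5)
  note nz = primitive_nonzero[OF ruling_point_primitive]
  obtain c where c: "c \<noteq> 0" "to_rat (ruling_point (l', m') (w', z')) = c *s to_rat (ruling_point (l, m) (w, z))"
    using eq proj_class_eq_iff[OF nz nz] pos cop by (auto simp: u' v' cayley_point_def)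
  have c_nth: "rat_of_int (ruling_point (l', m') (w', z') $ i) = c * rat_of_int (ruling_point (l, m) (w, z) $ i)" for i
    using c(2) by (simp add: vec_eq_iff)
  define L M W Z where "L = rat_of_int l" and "M = rat_of_int m" and "W = rat_of_int w" and "Z = rat_of_int z"
  define L' M' W' Z' where "L' = rat_of_int l'" and "M' = rat_of_int m'" and "W' = rat_of_int w'" and "Z' = rat_of_int z'"
  note defs = L_def M_def W_def Z_def L'_def M'_def W'_def Z'_def
  have rpos: "0 < M" "0 < W" "0 < M'" "0 < W'"
    using pos by (simp_all add: defs)
  have e0: "M'\<^sup>2 * W' = c * (M\<^sup>2 * W)" and e1: "L' * M' * W' = c * (L * M * W)"
    and e2: "L'\<^sup>2 * W' + M' * Z' = c * (L\<^sup>2 * W + M * Z)"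
    using c_nth[of 0] c_nth[of 1] c_nth[of 2] by (simp_all add: ruling_point_def defs)
  have "L' / M' = (L' * M' * W') / (M'\<^sup>2 * W')"
    using rpos by (simp add: power2_eq_square)
  also have "\<dots> = L / M"
    unfolding e0 e1 using rpos c(1) by (simp add: power2_eq_square)
  finally have "l' = l \<and> m' = m"
    using pos cop by (intro coprime_fraction_unique) (simp_all add: defs)
  then have lm: "l' = l" "m' = m" "L' = L" "M' = M"
    by (simp_all add: defs)
  have W': "W' = c * W"
    using e0 rpos by (simp add: lm)
  have "M * Z' = M * (c * Z)"
    using e2 by (simp add: lm W' algebra_simps)
  then have "Z' = c * Z"
    using rpos by simp
  then have "Z' / W' = Z / W"
    using W' c(1) by simp
  then have "z' = z \<and> w' = w"
    using pos cop by (intro coprime_fraction_unique) (simp_all add: defs coprime_commute)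
  with lm show "u = v"
    by (simp add: u' v')
qed

lemma cayley_point_in_V:
  assumes "u \<in> point_parameters"
  shows "cayley_point u \<in> V_points"
proof -
  obtain l m w z where u': "u = ((l, m), (w, z))"
      and pos: "0 < m" "0 < w" and cop: "coprime l m" "coprime w z"
    using assms by (auto simp: point_parameters_def)
  define x where "x = to_rat (ruling_point (l, m) (w, z))"
  have x0: "x \<noteq> 0"
    unfolding x_def using ruling_point_primitive[OF cop pos] by (rule primitive_nonzero)
  have u_eq: "cayley_point u = proj_class x"
    by (simp add: cayley_point_def u' x_def)
  have on: "x $ 0 * x $ 1 * x $ 2 - (x $ 0)\<^sup>2 * x $ 3 - (x $ 1) ^ 3 = 0"
    by (simp add: x_def ruling_point_def power2_eq_square power3_eq_cube algebra_simps)
  have "t $ 0 * t $ 1 * t $ 2 - (t $ 0)\<^sup>2 * t $ 3 - (t $ 1) ^ 3 = 0" if t: "t = c *s x" for t c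
  proof -
    have "t $ 0 * t $ 1 * t $ 2 - (t $ 0)\<^sup>2 * t $ 3 - (t $ 1) ^ 3 =
      c ^ 3 * (x $ 0 * x $ 1 * x $ 2 - (x $ 0)\<^sup>2 * x $ 3 - (x $ 1) ^ 3)"
      by (simp add: t power2_eq_square power3_eq_cube algebra_simps)
    then show ?thesis
      by (simp only: on mult_zero_right)
  qed
  then have "cayley_point u \<in> cayley_cubic"
    using x0 by (auto simp: cayley_cubic_def u_eq proj_class_in_projective_points mem_proj_class)
  moreover have "x \<in> cayley_point u"
    using x0 by (auto simp: u_eq mem_proj_class intro!: exI[of _ 1])
  moreover have "x $ 0 \<noteq> 0"
    using pos by (simp add: x_def ruling_point_def)
  ultimately show ?thesis
    by (auto simp: V_points_def double_line_def)
qed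

text \<open>
On the surface \<open>t\<^sub>0 = 0\<close> forces \<open>t\<^sub>1 = 0\<close>, so \<open>t\<^sub>0 \<noteq> 0\<close> on \<open>V\<close>, and \<open>(l, m)\<close> and \<open>(z, w)\<close> may be read off as reduced
fractions. No primitive representative has to be constructed first, since projective points only
matter up to a factor.
\<close>
lemma V_points_subset_cayley_points:
  assumes "P \<in> V_points"
  shows "P \<in> cayley_point ` point_parameters"
proof -
  have P: "P \<in> projective_points"
    and on: "\<And>t. t \<in> P \<Longrightarrow> t $ 0 * t $ 1 * t $ 2 - (t $ 0)\<^sup>2 * t $ 3 - (t $ 1) ^ 3 = 0"
    and off: "\<exists>t\<in>P. t $ 0 \<noteq> 0 \<or> t $ 1 \<noteq> 0"
    using assms by (auto simp: V_points_def cayley_cubic_def double_line_def)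
  obtain y where y: "y \<noteq> 0" "P = proj_class y"
    using P by (rule projective_points_cases)
  obtain x where x: "x \<in> P" "x $ 0 \<noteq> 0 \<or> x $ 1 \<noteq> 0"
    using off by blast
  have x0: "x $ 0 \<noteq> 0"
    using on[OF x(1)] x(2) by auto
  then have xnz: "x \<noteq> 0"
    by auto
  have Px: "P = proj_class x"
    using x(1) y xnz proj_class_eq_iff[OF y(1) xnz] by (simp add: mem_proj_class)
  obtain l m where lm: "0 < m" "coprime l m" "x $ 1 / x $ 0 = rat_of_int l / rat_of_int m"
    by (rule fraction_coprime)
  define L M where "L = rat_of_int l" and "M = rat_of_int m"
  have M: "M > 0"
    using lm by (simp add: M_def)
  \<comment> \<open>In a line of the ruling the coordinates of a point are linear in two parameters; those of \<open>x\<close> are \<open>s\<close> and \<open>r\<close>.\<close>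
  define s where "s = x $ 0 / M\<^sup>2"
  define r where "r = (x $ 2 - L\<^sup>2 * s) / M"
  have s0: "s \<noteq> 0"
    using x0 M by (simp add: s_def)
  have c0: "x $ 0 = M\<^sup>2 * s"
    using M by (simp add: s_def)
  have c1: "x $ 1 = L * M * s"
    using lm(3) x0 M by (simp add: c0 L_def[symmetric] M_def[symmetric] field_simps power2_eq_square)
  have c2: "x $ 2 = L\<^sup>2 * s + M * r"
    using M by (simp add: r_def)
  have "M ^ 4 * s\<^sup>2 * (x $ 3 - L * r) =
      - (M\<^sup>2 * s * (L * M * s) * (L\<^sup>2 * s + M * r) - (M\<^sup>2 * s)\<^sup>2 * x $ 3 - (L * M * s) ^ 3)"
    by (simp add: power2_eq_square power3_eq_cube power4_eq_xxxx algebra_simps)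
  also have "\<dots> = 0"
    using on[OF x(1)] unfolding c0 c1 c2 by simp
  finally have "M ^ 4 * s\<^sup>2 * (x $ 3 - L * r) = 0" .
  then have c3: "x $ 3 = L * r"
    using M s0 by auto
  obtain z w where wz: "0 < w" "coprime z w" "r / s = rat_of_int z / rat_of_int w"
    by (rule fraction_coprime)
  define W Z where "W = rat_of_int w" and "Z = rat_of_int z"
  have W: "W > 0"
    using wz by (simp add: W_def)
  have rs: "r = s / W * Z"
    using wz(3) s0 W by (simp add: W_def[symmetric] Z_def[symmetric] field_simps)
  have nz: "to_rat (ruling_point (l, m) (w, z)) \<noteq> 0"
    using lm wz by (intro primitive_nonzero ruling_point_primitive) (simp_all add: coprime_commute)
  have "x = (s / W) *s to_rat (ruling_point (l, m) (w, z))"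
    unfolding vec_eq_iff forall_index_4 using W
    by (simp add: c0 c1 c2 c3 rs ruling_point_def field_simps
        flip: L_def M_def W_def Z_def)
  moreover have "s / W \<noteq> 0"
    using s0 W by simp
  ultimately have "\<exists>c. c \<noteq> 0 \<and> x = c *s to_rat (ruling_point (l, m) (w, z))"
    by (intro exI[of _ "s / W"]) (rule conjI)
  then have "proj_class (to_rat (ruling_point (l, m) (w, z))) = proj_class x"
    using proj_class_eq_iff[OF nz xnz] by (rule iffD2[rotated])
  then have "P = cayley_point ((l, m), (w, z))"
    by (simp add: Px cayley_point_def)
  moreover have "((l, m), (w, z)) \<in> point_parameters"
    using lm wz by (simp add: point_parameters_def coprime_commute)
  ultimately show ?thesis
    by (rule image_eqI)
qed

lemma bij_betw_cayley_point: "bij_betw cayley_point point_parameters V_points"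
  using inj_on_cayley_point cayley_point_in_V V_points_subset_cayley_points
  by (auto simp: bij_betw_def)

lemma height_cayley_point:
  assumes "((l, m), (w, z)) \<in> point_parameters"
  shows "height (cayley_point ((l, m), (w, z))) =
    sqrt (of_int ((m\<^sup>2 * w)\<^sup>2 + (l * m * w)\<^sup>2 + (l\<^sup>2 * w + m * z)\<^sup>2 + (l * z)\<^sup>2))"
proof -
  have "ruling_point (l, m) (w, z) \<in> primitive_vectors"
    using assms by (intro ruling_point_primitive) (auto simp: point_parameters_def)
  then have "height (cayley_point ((l, m), (w, z))) =
      norm (\<chi> i. real_of_int (ruling_point (l, m) (w, z) $ i))"
    by (simp add: cayley_point_def height_primitive)
  also have "\<dots> = sqrt (of_int ((m\<^sup>2 * w)\<^sup>2 + (l * m * w)\<^sup>2 + (l\<^sup>2 * w + m * z)\<^sup>2 + (l * z)\<^sup>2))"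
    unfolding norm_vec_def L2_set_def sum_index_4 by (simp add: ruling_point_def)
  finally show ?thesis .
qed

section \<open>Points on a single line\<close>

definition line_parameters :: "(int \<times> int) set" where
  "line_parameters = {(l, m). 0 < m \<and> coprime l m}"

text \<open>
The coefficients are those of the squared norm of \<open>ruling_point (l, m) (w, z)\<close> as a form in \<open>w\<close> and \<open>z\<close>.
\<close>
definition line_points :: "int \<times> int \<Rightarrow> real \<Rightarrow> (int \<times> int) set" where
  "line_points = (\<lambda>(l, m) B. {(w, z) \<in> half_ellipse (of_int (m ^ 4 + l\<^sup>2 * m\<^sup>2 + l ^ 4))
     (of_int (l\<^sup>2 * m)) (of_int (l\<^sup>2 + m\<^sup>2)) B. coprime w z})"

lemma parameters_height_le:
  assumes "0 \<le> B"
  shows "{u \<in> point_parameters. height (cayley_point u) \<le> B} = (SIGMA p:line_parameters. line_points p B)"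
proof -
  have "((l, m), (w, z)) \<in> point_parameters \<and> height (cayley_point ((l, m), (w, z))) \<le> B \<longleftrightarrow>
      (l, m) \<in> line_parameters \<and> (w, z) \<in> line_points (l, m) B" for l m w z
  proof (cases "((l, m), (w, z)) \<in> point_parameters")
    case True
    define Q where "Q = (m\<^sup>2 * w)\<^sup>2 + (l * m * w)\<^sup>2 + (l\<^sup>2 * w + m * z)\<^sup>2 + (l * z)\<^sup>2"
    have "height (cayley_point ((l, m), (w, z))) \<le> B \<longleftrightarrow> sqrt (of_int Q) \<le> B"
      using True by (simp only: height_cayley_point Q_def)
    also have "\<dots> \<longleftrightarrow> of_int Q \<le> B\<^sup>2"
      using assms by (simp add: real_sqrt_le_iff[symmetric, of _ "B\<^sup>2"] del: real_sqrt_le_iff)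
    also have "Q = (m ^ 4 + l\<^sup>2 * m\<^sup>2 + l ^ 4) * w\<^sup>2 + 2 * (l\<^sup>2 * m) * w * z + (l\<^sup>2 + m\<^sup>2) * z\<^sup>2"
      by (simp add: Q_def power2_eq_square power4_eq_xxxx algebra_simps)
    finally show ?thesis
      using True by (simp add: point_parameters_def line_parameters_def line_points_def half_ellipse_def)
  qed (auto simp: point_parameters_def line_parameters_def line_points_def half_ellipse_def)
  then show ?thesis
    by (intro set_eqI) (simp add: split_paired_all)
qed

lemma parameters_height_neg:
  assumes "B < 0"
  shows "{u \<in> point_parameters. height (cayley_point u) \<le> B} = {}"
proof -
  have "0 \<le> height (cayley_point u)" if "u \<in> point_parameters" for u
  proof -
    obtain l m w z where u: "u = ((l, m), (w, z))"
      by (metis surj_pair)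
    show ?thesis
      using height_cayley_point[OF that[unfolded u]] unfolding u by (simp add: sum_power2_ge_zero)
  qed
  with assms show ?thesis
    by fastforce
qed

definition line_size :: "int \<times> int \<Rightarrow> nat" where
  "line_size = (\<lambda>(l, m). nat (max \<bar>l\<bar> m))"

text \<open>
Both bounds on the discriminant \<open>D\<close> come from \<open>d\<^sup>3 \<le> 4 D\<close>, where \<open>d \<ge> k\<^sup>2\<close>; this
inequality holds because \<open>4 D - d\<^sup>3\<close> is a form in \<open>l\<^sup>2\<close>, \<open>m\<^sup>2\<close> with nonnegative coefficients. Geometrically, the two basis
vectors of the plane over a line have norms of order \<open>k\<^sup>2\<close> and \<open>k\<close>, and the angle between them is
bounded below.
\<close>
lemma line_form_bounds:
  assumes "(l, m) \<in> line_parameters"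
  defines "d \<equiv> real_of_int (l\<^sup>2 + m\<^sup>2)" and "D \<equiv> real_of_int (f_form m l)" and "k \<equiv> real (line_size (l, m))"
  shows "1 \<le> k" "k\<^sup>2 \<le> d" "0 < D" "sqrt (d / D) \<le> 2 / d" "1 / sqrt D \<le> 2 / k ^ 3"
proof -
  have m: "0 < m"
    using assms by (simp add: line_parameters_def)
  have k: "k = of_int (max \<bar>l\<bar> m)"
    using m by (simp add: k_def line_size_def)
  show k1: "1 \<le> k"
    using m unfolding k by simp
  have "(max \<bar>l\<bar> m)\<^sup>2 \<le> l\<^sup>2 + m\<^sup>2"
    by (auto simp: max_def)
  then show kd: "k\<^sup>2 \<le> d"
    unfolding k d_def of_int_power[symmetric] by (simp only: of_int_le_iff)
  have d1: "1 \<le> d"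
    using k1 kd by (metis one_le_power order_trans)
  have "4 * f_form m l = (l\<^sup>2 + m\<^sup>2) ^ 3 + (3 * m ^ 6 + 5 * m ^ 4 * l\<^sup>2 + m\<^sup>2 * l ^ 4 + 3 * l ^ 6)"
    by (simp add: f_form_def power2_eq_square power3_eq_cube eval_nat_numeral algebra_simps)
  then have "(l\<^sup>2 + m\<^sup>2) ^ 3 \<le> 4 * f_form m l"
    by simp
  then have "real_of_int ((l\<^sup>2 + m\<^sup>2) ^ 3) \<le> real_of_int (4 * f_form m l)"
    by (simp only: of_int_le_iff)
  then have D: "d ^ 3 \<le> 4 * D"
    unfolding d_def D_def of_int_power of_int_mult of_int_numeral .
  have "0 < d ^ 3"
    using d1 by simp
  with D show D0: "0 < D"
    by linarith
  have "d / D \<le> (2 / d)\<^sup>2"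
    using D D0 d1 by (simp add: field_simps power2_eq_square power3_eq_cube)
  then show "sqrt (d / D) \<le> 2 / d"
    using d1 by (intro real_le_lsqrt) auto
  have "(k ^ 3)\<^sup>2 = (k\<^sup>2) ^ 3"
    by (simp flip: power_mult)
  also have "\<dots> \<le> d ^ 3"
    using kd by (intro power_mono) auto
  finally have "(k ^ 3 / 2)\<^sup>2 \<le> D"
    using D by (simp add: power_divide)
  then have "k ^ 3 / 2 \<le> sqrt D"
    by (rule real_le_rsqrt)
  moreover have "0 < k ^ 3 / 2"
    using k1 by simp
  ultimately show "1 / sqrt D \<le> 2 / k ^ 3"
    using D0 by (simp add: field_simps)
qed

text \<open>
The arguments of \<open>f\<close> appear here in the opposite order to that of the theorem.
\<close>
lemma line_discriminant:
  "real_of_int (m ^ 4 + l\<^sup>2 * m\<^sup>2 + l ^ 4) * of_int (l\<^sup>2 + m\<^sup>2) - (of_int (l\<^sup>2 * m))\<^sup>2 = of_int (f_form m l)"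
proof -
  have "(m ^ 4 + l\<^sup>2 * m\<^sup>2 + l ^ 4) * (l\<^sup>2 + m\<^sup>2) - (l\<^sup>2 * m)\<^sup>2 = f_form m l"
    by (simp add: f_form_def eval_nat_numeral algebra_simps)
  then show ?thesis
    by (simp only: of_int_mult[symmetric] of_int_power[symmetric] of_int_diff[symmetric])
qed

text \<open>
A point has \<open>w \<ge> 1\<close>, and the rows of the ellipse end at \<open>B \<surd>(d / D) \<le> 2 B / d\<close>; so \<open>d \<le> 2 B\<close>.
\<close>
lemma line_points_nonempty_imp:
  assumes p: "p \<in> line_parameters" and "0 \<le> B" and ne: "line_points p B \<noteq> {}"
  shows "real (line_size p) \<le> sqrt (2 * B)"
proof -
  obtain l m where lm: "p = (l, m)"
    by (cases p)
  define d D k where "d = real_of_int (l\<^sup>2 + m\<^sup>2)" and "D = real_of_int (f_form m l)" and "k = real (line_size (l, m))"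
  note b = line_form_bounds[OF p[unfolded lm], folded d_def D_def k_def]
  have d0: "d > 0"
    using b(1,2) by (smt (verit) zero_less_power)
  obtain w z where "(w, z) \<in> half_ellipse (of_int (m ^ 4 + l\<^sup>2 * m\<^sup>2 + l ^ 4)) (of_int (l\<^sup>2 * m)) d B"
    using ne by (auto simp: lm line_points_def d_def)
  then have "0 < w \<and> w \<le> \<lfloor>B * sqrt (d / D)\<rfloor>"
    using half_ellipse_fst_le[of d "of_int (m ^ 4 + l\<^sup>2 * m\<^sup>2 + l ^ 4)" "of_int (l\<^sup>2 * m)" B w z] d0 b(3) \<open>0 \<le> B\<close>
    unfolding d_def D_def line_discriminant by simp
  then have "1 \<le> B * sqrt (d / D)"
    by linarith
  also have "\<dots> \<le> B * (2 / d)"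
    using b(4) \<open>0 \<le> B\<close> by (rule mult_left_mono)
  finally have "d \<le> 2 * B"
    using d0 by (simp add: field_simps)
  then have "k\<^sup>2 \<le> 2 * B"
    using b(2) by simp
  then show ?thesis
    unfolding lm k_def by (rule real_le_rsqrt)
qed

text \<open>
The factor depending on the form in \<open>card_coprime_half_ellipse\<close> is at most \<open>(4 + 2 \<pi>) / \<surd>d \<le> 12 / k\<close>, and
\<open>Y = 2 B\<close> is admissible for every line.
\<close>
lemma card_line_points:
  assumes p: "(l, m) \<in> line_parameters" and B: "1 \<le> B"
  shows "\<bar>real (card (line_points (l, m) B)) - pi / (2 * zeta 2) * B\<^sup>2 * (1 / sqrt (of_int (f_form m l)))\<bar>
    \<le> 12 * B * (1 + ln (2 * B)) * (1 / real (line_size (l, m)))"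
proof -
  define d D k where "d = real_of_int (l\<^sup>2 + m\<^sup>2)" and "D = real_of_int (f_form m l)" and "k = real (line_size (l, m))"
  note b = line_form_bounds[OF p, folded d_def D_def k_def]
  have d1: "d \<ge> 1"
    using b(1,2) by (smt (verit) one_le_power)
  have s: "sqrt (d / D) \<le> 2 / d"
    by (rule b(4))
  also have "\<dots> \<le> 2 / sqrt d"
    using d1 by (intro divide_left_mono) (auto intro!: real_le_lsqrt simp: self_le_power)
  finally have s1: "sqrt (d / D) \<le> 2 / sqrt d" .
  have "sqrt (d / D) \<le> 2"
  proof -
    have "2 / d \<le> 2"
      using d1 by (simp add: divide_le_eq)
    with b(4) show ?thesis
      by linarith
  qed
  then have Y: "B * sqrt (d / D) \<le> 2 * B"
    using B mult_left_mono[of "sqrt (d / D)" 2 B] by simp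
  have kd: "k \<le> sqrt d"
    using b(2) by (rule real_le_rsqrt)
  have "\<bar>real (card (line_points (l, m) B)) - pi * B\<^sup>2 / (2 * zeta 2 * sqrt D)\<bar>
      \<le> B * (1 + ln (2 * B)) * (sqrt (d / D) + (2 + 2 * pi) / sqrt d)"
    using card_coprime_half_ellipse[of d "of_int (m ^ 4 + l\<^sup>2 * m\<^sup>2 + l ^ 4)" "of_int (l\<^sup>2 * m)" B "2 * B"] d1 b(3) B Y
    unfolding d_def D_def line_discriminant line_points_def by simp
  also have "\<dots> \<le> B * (1 + ln (2 * B)) * (12 / k)"
  proof (rule mult_left_mono)
    have "sqrt (d / D) + (2 + 2 * pi) / sqrt d \<le> (4 + 2 * pi) / sqrt d"
      using s1 by (simp add: add_divide_distrib)
    also have "\<dots> \<le> 12 / k"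
      using kd b(1) pi_less_4 by (intro frac_le) auto
    finally show "sqrt (d / D) + (2 + 2 * pi) / sqrt d \<le> 12 / k" .
  qed (use B in auto)
  finally show ?thesis
    by (simp add: D_def k_def mult_ac)
qed

section \<open>Sums over all lines\<close>

text \<open>
Either \<open>m = k\<close> and \<open>|l| \<le> k\<close>, or \<open>|l| = k\<close> and \<open>1 \<le> m < k\<close>: at most \<open>(2 k + 1) + 2 (k - 1)\<close> lines.
\<close>
lemma card_lines_of_size_le:
  assumes "finite F" "F \<subseteq> line_parameters"
  shows "card {p \<in> F. line_size p = k} \<le> 4 * k"
proof (cases "k = 0")
  case True
  have "{p \<in> F. line_size p = k} = {}"
    using assms(2) True by (auto simp: line_parameters_def line_size_def)
  then show ?thesis
    by (simp only: card.empty)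
next
  case False
  let ?A = "{- int k..int k} \<times> {int k}" and ?C = "{- int k, int k} \<times> {1..int k - 1}"
  have "{p \<in> F. line_size p = k} \<subseteq> ?A \<union> ?C"
  proof
    fix p assume p: "p \<in> {p \<in> F. line_size p = k}"
    obtain l m where lm: "p = (l, m)"
      by (cases p)
    have "0 < m" "max \<bar>l\<bar> m = int k"
      using p assms(2) by (auto simp: lm line_parameters_def line_size_def)
    then have "m = int k \<and> \<bar>l\<bar> \<le> int k \<or> 0 < m \<and> m < int k \<and> \<bar>l\<bar> = int k"
      by linarith
    then show "p \<in> ?A \<union> ?C"
      by (auto simp: lm abs_if split: if_splits)
  qed
  then have "card {p \<in> F. line_size p = k} \<le> card (?A \<union> ?C)"
    by (rule card_mono[rotated]) simp
  also have "\<dots> \<le> card ?A + card ?C"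
    by (rule card_Un_le)
  also have "\<dots> = (2 * k + 1) + 2 * (k - 1)"
    using False by (simp add: card_cartesian_product card_insert_if nat_diff_distrib)
  also have "\<dots> \<le> 4 * k"
    using False by simp
  finally show ?thesis .
qed

lemma sum_over_lines_le:
  fixes g :: "nat \<Rightarrow> real"
  assumes F: "finite F" "F \<subseteq> line_parameters" and T: "line_size ` F \<subseteq> T" "finite T" and g: "\<And>k. 0 \<le> g k"
  shows "(\<Sum>p\<in>F. g (line_size p)) \<le> (\<Sum>k\<in>T. 4 * real k * g k)"
proof -
  have "(\<Sum>p\<in>F. g (line_size p)) = (\<Sum>k\<in>T. \<Sum>p | p \<in> F \<and> line_size p = k. g (line_size p))"
    using sum.group[OF F(1) T(2,1), of "\<lambda>p. g (line_size p)"] by simp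
  also have "\<dots> = (\<Sum>k\<in>T. real (card {p \<in> F. line_size p = k}) * g k)"
    by (intro sum.cong refl) simp
  also have "\<dots> \<le> (\<Sum>k\<in>T. 4 * real k * g k)"
  proof (intro sum_mono mult_right_mono g)
    fix k
    show "real (card {p \<in> F. line_size p = k}) \<le> 4 * real k"
      using card_lines_of_size_le[OF F, of k] by linarith
  qed
  finally show ?thesis .
qed

definition line_weight :: "int \<times> int \<Rightarrow> real" where
  "line_weight = (\<lambda>(l, m). 1 / sqrt (of_int (f_form m l)))"

lemma line_weight_nonneg: "0 \<le> line_weight p"
proof -
  have "0 \<le> f_form m l" for l m
    by (simp add: f_form_def)
  then show ?thesis
    by (simp add: line_weight_def case_prod_unfold)
qed

text \<open>
At most \<open>4 k\<close> lines of size \<open>k\<close> have weight at most \<open>2 / k\<^sup>3\<close> each. The case \<open>M = 0\<close> gives summability over all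
lines, the general case the size of the main terms of the lines without points.
\<close>
lemma sum_line_weight_tail:
  assumes F: "finite F" "F \<subseteq> {p \<in> line_parameters. M < line_size p}"
  shows "sum line_weight F \<le> 16 / real (Suc M)"
proof (cases "F = {}")
  case False
  define N where "N = Max (line_size ` F)"
  have le: "line_size p \<le> N" if "p \<in> F" for p
    using that F(1) by (simp add: N_def)
  obtain p where "p \<in> F"
    using False by blast
  then have MN: "M < N"
    using le[of p] F(2) by auto
  have "sum line_weight F \<le> (\<Sum>p\<in>F. 2 / real (line_size p) ^ 3)"
  proof (rule sum_mono)
    fix p assume "p \<in> F"
    then have "(fst p, snd p) \<in> line_parameters"
      using F(2) by auto
    from line_form_bounds(5)[OF this] show "line_weight p \<le> 2 / real (line_size p) ^ 3"
      by (simp add: line_weight_def case_prod_unfold)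
  qed
  also have "\<dots> \<le> (\<Sum>k = Suc M..N. 4 * real k * (2 / real k ^ 3))"
    using F le by (intro sum_over_lines_le) auto
  also have "\<dots> = 8 * (\<Sum>k = Suc M..N. 1 / real k ^ 2)"
    unfolding sum_distrib_left by (intro sum.cong refl) (simp add: power2_eq_square power3_eq_cube)
  also have "\<dots> \<le> 8 * (2 / real (Suc M) - 1 / real N)"
    using sum_inverse_squares_tail[OF MN] by simp
  also have "\<dots> \<le> 16 / real (Suc M)"
    by simp
  finally show ?thesis .
qed simp

lemma line_weight_summable: "line_weight summable_on line_parameters"
proof (rule nonneg_bdd_above_summable_on)
  have "sum line_weight F \<le> 16" if "F \<in> {F. F \<subseteq> line_parameters \<and> finite F}" for F
  proof -
    have "F \<subseteq> {p \<in> line_parameters. 0 < line_size p}"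
      using that by (auto simp: line_parameters_def line_size_def)
    then show ?thesis
      using sum_line_weight_tail[of F 0] that by simp
  qed
  then show "bdd_above (sum line_weight ` {F. F \<subseteq> line_parameters \<and> finite F})"
    by (rule bdd_aboveI2)
qed (rule line_weight_nonneg)

lemma infsum_line_weight_tail:
  "infsum line_weight {p \<in> line_parameters. M < line_size p} \<le> 16 / real (Suc M)"
proof (rule infsum_le_finite_sums)
  show "line_weight summable_on {p \<in> line_parameters. M < line_size p}"
    using line_weight_summable by (rule summable_on_subset) auto
qed (rule sum_line_weight_tail)

section \<open>The counting function\<close>

lemma finite_lines_of_bounded_size: "finite {p \<in> line_parameters. line_size p \<le> M}"
proof (rule finite_subset)
  show "{p \<in> line_parameters. line_size p \<le> M} \<subseteq> {- int M..int M} \<times> {- int M..int M}"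
    by (auto simp: line_parameters_def line_size_def)
qed simp

lemma parameters_height_le_bounded:
  assumes "0 \<le> B"
  shows "{u \<in> point_parameters. height (cayley_point u) \<le> B} =
    (SIGMA p:{p \<in> line_parameters. line_size p \<le> nat \<lfloor>sqrt (2 * B)\<rfloor>}. line_points p B)"
proof -
  have "line_size p \<le> nat \<lfloor>sqrt (2 * B)\<rfloor>" if "p \<in> line_parameters" "q \<in> line_points p B" for p q
    using line_points_nonempty_imp[OF that(1) assms] that(2) by (intro le_nat_floor) auto
  then have "x \<in> (SIGMA p:line_parameters. line_points p B) \<longleftrightarrow>
      x \<in> (SIGMA p:{p \<in> line_parameters. line_size p \<le> nat \<lfloor>sqrt (2 * B)\<rfloor>}. line_points p B)" for x
    by (cases x) auto
  then show ?thesis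
    unfolding parameters_height_le[OF assms] by (rule set_eqI)
qed

lemma finite_line_points:
  assumes "p \<in> line_parameters" "0 \<le> B"
  shows "finite (line_points p B)"
proof -
  obtain l m where lm: "p = (l, m)"
    by (cases p)
  define d where "d = real_of_int (l\<^sup>2 + m\<^sup>2)"
  have "d > 0"
    using line_form_bounds(1,2)[OF assms(1)[unfolded lm], folded d_def] by (smt (verit) zero_less_power)
  then have "finite (half_ellipse (of_int (m ^ 4 + l\<^sup>2 * m\<^sup>2 + l ^ 4)) (of_int (l\<^sup>2 * m)) d B)"
    using line_form_bounds(3)[OF assms(1)[unfolded lm]] assms(2) unfolding d_def
    by (intro finite_half_ellipse) (simp_all only: line_discriminant)
  then show ?thesis
    unfolding lm line_points_def d_def by (auto elim: rev_finite_subset)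
qed

lemma V_points_height_le:
  "{P \<in> V_points. height P \<le> B} = cayley_point ` {u \<in> point_parameters. height (cayley_point u) \<le> B}"
  unfolding bij_betw_imp_surj_on[OF bij_betw_cayley_point, symmetric] by auto

lemma finite_V_points_height_le: "finite {P \<in> V_points. height P \<le> B}"
proof (cases "0 \<le> B")
  case True
  show ?thesis
    unfolding V_points_height_le parameters_height_le_bounded[OF True]
    by (intro finite_imageI finite_SigmaI finite_lines_of_bounded_size finite_line_points True) auto
next
  case False
  then have "{u \<in> point_parameters. height (cayley_point u) \<le> B} = {}"
    by (intro parameters_height_neg) simp
  then show ?thesis
    by (simp only: V_points_height_le image_empty finite.emptyI)
qed

lemma counting_function_eq_sum:
  assumes "0 \<le> B"
  shows "counting_function B =
    (\<Sum>p | p \<in> line_parameters \<and> line_size p \<le> nat \<lfloor>sqrt (2 * B)\<rfloor>. card (line_points p B))"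
proof -
  have "counting_function B = card {u \<in> point_parameters. height (cayley_point u) \<le> B}"
    unfolding counting_function_def V_points_height_le
    by (rule card_image[OF inj_on_subset[OF inj_on_cayley_point]]) simp
  also have "\<dots> = (\<Sum>p | p \<in> line_parameters \<and> line_size p \<le> nat \<lfloor>sqrt (2 * B)\<rfloor>. card (line_points p B))"
    unfolding parameters_height_le_bounded[OF assms]
    using finite_lines_of_bounded_size finite_line_points assms by (intro card_SigmaI) auto
  finally show ?thesis .
qed

text \<open>
The lines are cut at size \<open>M\<close>, the integer part of \<open>\<surd>(2 B)\<close>, beyond which no point is counted. Up to \<open>M\<close>
each line is estimated separately; beyond \<open>M\<close> the main terms are themselves small.
\<close>
lemma counting_function_estimate:
  assumes B: "1 \<le> B"
  shows "\<bar>real (counting_function B) - pi * B\<^sup>2 / (2 * zeta 2) * infsum line_weight line_parameters\<bar>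
    \<le> 96 * (B * sqrt B) * (1 + ln (2 * B)) + 32 * (B * sqrt B)"
proof -
  define M where "M = nat \<lfloor>sqrt (2 * B)\<rfloor>"
  define c where "c = pi / (2 * zeta 2)"
  define F where "F = {p \<in> line_parameters. line_size p \<le> M}"
  define G where "G = {p \<in> line_parameters. M < line_size p}"
  have sq: "0 \<le> sqrt (2 * B)"
    using B by simp
  have M: "real M \<le> sqrt (2 * B)" "sqrt (2 * B) \<le> real (Suc M)"
    using sq unfolding M_def by linarith+
  have "sqrt (2 * B) \<le> sqrt (4 * B)"
    using B by (intro real_sqrt_le_mono) simp
  then have M2: "real M \<le> 2 * sqrt B"
    using M(1) by (simp add: real_sqrt_mult)
  have "sqrt B \<le> sqrt (2 * B)"
    using B by (intro real_sqrt_le_mono) simp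
  then have M3: "sqrt B \<le> real (Suc M)"
    using M(2) by linarith
  have c: "0 \<le> c" "c \<le> 2"
  proof -
    show "0 \<le> c"
      using zeta_2_ge_1 by (simp add: c_def)
    have "c \<le> 4 / 2"
      unfolding c_def using zeta_2_ge_1 pi_less_4 by (intro frac_le) auto
    then show "c \<le> 2"
      by simp
  qed
  have ln0: "0 \<le> ln (2 * B)"
    using B by simp
  have finF: "finite F"
    unfolding F_def by (rule finite_lines_of_bounded_size)
  have "line_parameters = F \<union> G" "F \<inter> G = {}"
    by (auto simp: F_def G_def)
  moreover have "line_weight summable_on F" "line_weight summable_on G"
    using line_weight_summable by (auto intro: summable_on_subset simp: F_def G_def)
  ultimately have split: "infsum line_weight line_parameters = sum line_weight F + infsum line_weight G"
    using infsum_Un_disjoint[of line_weight F G] finF by simp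
  have G: "0 \<le> infsum line_weight G" "infsum line_weight G \<le> 16 / real (Suc M)"
    using infsum_line_weight_tail[of M] by (auto simp: G_def intro!: infsum_nonneg line_weight_nonneg)
  have "real (counting_function B) = (\<Sum>p\<in>F. real (card (line_points p B)))"
    using B by (simp add: counting_function_eq_sum F_def M_def)
  then have "\<bar>real (counting_function B) - c * B\<^sup>2 * sum line_weight F\<bar> =
      \<bar>\<Sum>p\<in>F. real (card (line_points p B)) - c * B\<^sup>2 * line_weight p\<bar>"
    by (simp add: sum_subtractf sum_distrib_left)
  also have "\<dots> \<le> (\<Sum>p\<in>F. 12 * B * (1 + ln (2 * B)) * (1 / real (line_size p)))"
  proof (rule order_trans[OF sum_abs sum_mono])
    fix p assume "p \<in> F"
    then have "(fst p, snd p) \<in> line_parameters"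
      by (simp add: F_def)
    from card_line_points[OF this B]
    show "\<bar>real (card (line_points p B)) - c * B\<^sup>2 * line_weight p\<bar>
        \<le> 12 * B * (1 + ln (2 * B)) * (1 / real (line_size p))"
      by (simp add: c_def line_weight_def case_prod_unfold)
  qed
  also have "\<dots> = 12 * B * (1 + ln (2 * B)) * (\<Sum>p\<in>F. 1 / real (line_size p))"
    by (simp add: sum_distrib_left)
  also have "\<dots> \<le> 12 * B * (1 + ln (2 * B)) * (8 * sqrt B)"
  proof (rule mult_left_mono)
    have "(\<Sum>p\<in>F. 1 / real (line_size p)) \<le> (\<Sum>k = 1..M. 4 * real k * (1 / real k))"
      using finF by (intro sum_over_lines_le) (auto simp: F_def line_parameters_def line_size_def)
    also have "\<dots> = (\<Sum>k = 1..M. 4)"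
      by (intro sum.cong) auto
    also have "\<dots> \<le> 8 * sqrt B"
      using M2 by simp
    finally show "(\<Sum>p\<in>F. 1 / real (line_size p)) \<le> 8 * sqrt B" .
  qed (use B ln0 in auto)
  finally have near: "\<bar>real (counting_function B) - c * B\<^sup>2 * sum line_weight F\<bar> \<le> 96 * (B * sqrt B) * (1 + ln (2 * B))"
    by (simp add: mult_ac)
  have "c * B\<^sup>2 * infsum line_weight G \<le> 2 * B\<^sup>2 * (16 / sqrt B)"
  proof (intro mult_mono)
    have "16 / real (Suc M) \<le> 16 / sqrt B"
      using M3 B by (intro divide_left_mono) auto
    then show "infsum line_weight G \<le> 16 / sqrt B"
      using G(2) by linarith
  qed (use c G B in auto)
  also have "\<dots> = 32 * (B * (B / sqrt B))"
    by (simp add: power2_eq_square)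
  also have "B / sqrt B = sqrt B"
    using B by (simp add: real_div_sqrt)
  finally have far: "c * B\<^sup>2 * infsum line_weight G \<le> 32 * (B * sqrt B)" .
  have "0 \<le> c * B\<^sup>2 * infsum line_weight G"
    using c G by simp
  then have "\<bar>real (counting_function B) - c * B\<^sup>2 * infsum line_weight line_parameters\<bar>
      \<le> 96 * (B * sqrt B) * (1 + ln (2 * B)) + 32 * (B * sqrt B)"
    using near far unfolding split distrib_left by linarith
  then show ?thesis
    by (simp add: c_def)
qed

section \<open>Exchanging the two parameters of a line\<close>

text \<open>
Exchanges \<open>l\<close> and \<open>m\<close> up to sign. The sign of \<open>l\<close> is moved to the new first coordinate, so that the
second one remains positive. The line \<open>(0, 1)\<close> has to stay fixed, as its exchange \<open>(1, 0)\<close> would be the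
double line.
\<close>
definition swap_parameter :: "int \<times> int \<Rightarrow> int \<times> int" where
  "swap_parameter = (\<lambda>(l, m). if l = 0 then (l, m) else (sgn l * m, \<bar>l\<bar>))"

lemma bij_betw_swap_parameter: "bij_betw swap_parameter line_parameters line_parameters"
proof (rule bij_betw_byWitness[where f' = swap_parameter])
  show "\<forall>p\<in>line_parameters. swap_parameter (swap_parameter p) = p"
    by (auto simp: swap_parameter_def line_parameters_def sgn_mult abs_mult sgn_if)
  then show "\<forall>p\<in>line_parameters. swap_parameter (swap_parameter p) = p" .
  show "swap_parameter ` line_parameters \<subseteq> line_parameters"
    by (auto simp: swap_parameter_def line_parameters_def coprime_commute sgn_if split: if_splits)
  then show "swap_parameter ` line_parameters \<subseteq> line_parameters" .
qed

text \<open>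
The form is even in both variables, so signs do not matter. On the fixed line \<open>(0, 1)\<close> the claim is
\<open>f(0, 1) = f(1, 0)\<close>.
\<close>
lemma f_form_swap_parameter:
  assumes "(l, m) \<in> line_parameters"
  shows "f_form (fst (swap_parameter (l, m))) (snd (swap_parameter (l, m))) = f_form m l"
proof (cases "l = 0")
  case True
  then have "m = 1"
    using assms by (auto simp: line_parameters_def)
  with True show ?thesis
    by (simp add: swap_parameter_def f_form_def)
next
  case False
  then have "sgn l ^ 2 = 1" "sgn l ^ 4 = 1" "sgn l ^ 6 = 1"
    by (auto simp: sgn_if)
  with False show ?thesis
    by (simp add: swap_parameter_def f_form_def power_mult_distrib power_even_abs)
qed

definition vec2 :: "int \<times> int \<Rightarrow> int ^ 2" where
  "vec2 p = (\<chi> i. if i = 0 then fst p else snd p)"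

lemma vec2_nth [simp]: "vec2 p $ 0 = fst p" "vec2 p $ 1 = snd p"
  by (simp_all add: vec2_def)

lemma forall_index_2: "(\<forall>i::2. P i) \<longleftrightarrow> P 0 \<and> P 1"
proof -
  have "(2::2) = 0"
    by simp
  then show ?thesis
    unfolding forall_2 by (simp only:) blast
qed

lemma bij_betw_vec2: "bij_betw vec2 line_parameters ruling_parameters"
proof (rule bij_betw_byWitness[where f' = "\<lambda>v. (v $ 0, v $ 1)"])
  have "\<forall>i::2. i \<in> {0, 1}"
    unfolding forall_index_2 by simp
  then have indices: "(UNIV :: 2 set) = {0, 1}"
    by auto
  have "Gcd (range (\<lambda>i. v $ i)) = gcd (v $ 0) (v $ 1)" for v :: "int ^ 2"
    unfolding indices by simp
  then have mem: "v \<in> ruling_parameters \<longleftrightarrow> (v $ 0, v $ 1) \<in> line_parameters" for v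
    by (auto simp: ruling_parameters_def primitive_vectors_def line_parameters_def coprime_iff_gcd_eq_1)
  show "vec2 ` line_parameters \<subseteq> ruling_parameters"
    by (rule image_subsetI) (simp add: mem)
  show "(\<lambda>v. (v $ 0, v $ 1)) ` ruling_parameters \<subseteq> line_parameters"
    by (rule image_subsetI) (simp only: mem)
  show "\<forall>v\<in>ruling_parameters. vec2 (v $ 0, v $ 1) = v"
    by (simp add: vec_eq_iff forall_index_2)
qed simp

lemma line_weight_reindex:
  fixes h :: "int ^ 2 \<Rightarrow> real"
  defines "h \<equiv> \<lambda>v. 1 / sqrt (of_int (f_form (v $ 0) (v $ 1)))"
  shows "h summable_on ruling_parameters" "infsum h ruling_parameters = infsum line_weight line_parameters"
proof -
  have bij: "bij_betw (vec2 \<circ> swap_parameter) line_parameters ruling_parameters"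
    using bij_betw_swap_parameter bij_betw_vec2 by (rule bij_betw_trans)
  have eq: "h ((vec2 \<circ> swap_parameter) p) = line_weight p" if "p \<in> line_parameters" for p
    using f_form_swap_parameter[of "fst p" "snd p"] that
    by (simp add: h_def line_weight_def case_prod_unfold)
  have "(\<lambda>p. h ((vec2 \<circ> swap_parameter) p)) summable_on line_parameters \<longleftrightarrow> line_weight summable_on line_parameters"
    using eq by (rule summable_on_cong)
  then show "h summable_on ruling_parameters"
    using line_weight_summable summable_on_reindex_bij_betw[OF bij, of h] by simp
  have "infsum (\<lambda>p. h ((vec2 \<circ> swap_parameter) p)) line_parameters = infsum line_weight line_parameters"
    using eq by (rule infsum_cong)
  then show "infsum h ruling_parameters = infsum line_weight line_parameters"
    using infsum_reindex_bij_betw[OF bij, of h] by simp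
qed

section \<open>The asymptotic formula\<close>

theorem theorem1p1:
  shows "(\<forall>B. finite {P \<in> V_points. height P \<le> B}) \<and>
    (\<lambda>v. 1 / sqrt (real_of_int (f_form (v $ 0) (v $ 1)))) summable_on ruling_parameters \<and>
    (\<lambda>B. real (counting_function B) -
        pi * B^2 / (2 * zeta 2) *
          (\<Sum>\<^sub>\<infinity>v\<in>ruling_parameters. 1 / sqrt (real_of_int (f_form (v $ 0) (v $ 1)))))
      \<in> O[at_top](\<lambda>B. B powr (3/2) * ln B)"
proof (intro conjI allI finite_V_points_height_le line_weight_reindex(1))
  show "(\<lambda>B. real (counting_function B) -
        pi * B^2 / (2 * zeta 2) *
          (\<Sum>\<^sub>\<infinity>v\<in>ruling_parameters. 1 / sqrt (real_of_int (f_form (v $ 0) (v $ 1)))))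
      \<in> O[at_top](\<lambda>B. B powr (3/2) * ln B)"
    unfolding line_weight_reindex(2)
  proof (rule landau_o.bigI[where c = 320], simp, rule eventually_at_top_linorderI[of 3])
    fix B :: real
    assume B: "3 \<le> B"
    have "exp 1 \<le> B"
      using exp_le B by linarith
    then have lnB: "1 \<le> ln B"
      using B by (subst ln_ge_iff) auto
    have "ln (2 * B) \<le> 2 * ln B"
      using B lnB ln_le_minus_one[of 2] by (simp add: ln_mult)
    then have "96 * (B * sqrt B) * (1 + ln (2 * B)) + 32 * (B * sqrt B)
        \<le> 96 * (B * sqrt B) * (3 * ln B) + 32 * (B * sqrt B) * ln B"
      using B lnB by (intro add_mono mult_left_mono) auto
    also have "\<dots> = 320 * (B * sqrt B * ln B)"
      by (simp add: algebra_simps)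
    finally have bound: "96 * (B * sqrt B) * (1 + ln (2 * B)) + 32 * (B * sqrt B)
        \<le> 320 * (B * sqrt B * ln B)" .
    have "B powr (3/2) = B powr (1 + 1/2)"
      by simp
    also have "\<dots> = B * sqrt B"
      using B by (subst powr_add) (simp add: powr_half_sqrt)
    finally have "norm (B powr (3/2) * ln B) = B * sqrt B * ln B"
      using B lnB by simp
    then show "norm (real (counting_function B) - pi * B^2 / (2 * zeta 2) * infsum line_weight line_parameters)
        \<le> 320 * norm (B powr (3/2) * ln B)"
      using counting_function_estimate[of B] B bound unfolding real_norm_def by linarith
  qed
qed

end
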